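(* For every $n\ge 3$ and every triangulation $\mathcal{T}$ of $P_n$ such that some triangle of $\mathcal{T}$ does not contain the vertex $0$, there exists a category with cofibrations $\mathcal{C}$ such that the $2$-Segal map $f_{\mathcal{T}}\colon \mathrm{iso}(s_n\mathcal{C})\to\lim_{I\in\mathcal{T}}\mathrm{iso}(s_I\mathcal{C})$ of the simplicial set $\mathrm{iso}(s_\bullet\mathcal{C})$ is not surjective.
   Context: A category with cofibrations is a (small) category $\mathcal{C}$ with a zero object $0$ and a distinguished class of morphisms, the cofibrations (written $\rightarrowtail$), such that: for every object $A$ the map $0\to A$ is a cofibration; every isomorphism is a cofibration; cofibrations are closed under composition; the pushout of a cofibration along any morphism exists and is a cofibration. A cofibration sequence $A\rightarrowtail B\twoheadrightarrow D$ is a cofibration followed by its cokernel, i.e. $D$ is a pushout of $0\leftarrow A\rightarrowtail B$. For a finite nonempty totally ordered set $I$ (e.g. $[n]=\{0<1<\dots<n\}$), $\mathrm{Ar}(I)$ is the poset of pairs $(i,j)$, $i\le j$ in $I$, with $(i,j)\le(i',j')$ iff $i\le i'$ and $j\le j'$. $S_I\mathcal{C}$ is the full subcategory of functors $A\colon \mathrm{Ar}(I)\to\mathcal{C}$, $(i,j)\mapsto A_{i,j}$, with $A_{j,j}=0$ for all $j$ and $A_{i,j}\rightarrowtail A_{i,k}\twoheadrightarrow A_{j,k}$ a cofibration sequence for all $i<j<k$; $S_n\mathcal{C}=S_{[n]}\mathcal{C}$. Precomposition makes $[n]\mapsto S_n\mathcal{C}$ a simplicial category. $\mathrm{iso}(s_I\mathcal{C})$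 is the set of isomorphism classes of objects of $S_I\mathcal{C}$, and $\mathrm{iso}(s_\bullet\mathcal{C})$ is the simplicial set $[n]\mapsto\mathrm{iso}(s_n\mathcal{C})$. $P_n$ is the regular $(n+1)$-gon with vertices labeled cyclically $0,1,\dots,n$. A triangulation $\mathcal{T}$ of $P_n$ is a subdivision into triangles with vertices among those of $P_n$, any two triangles being disjoint or meeting in a common face, in the usual sense. A diagonal is an edge of a triangle that is not an edge of $P_n$. Regard $\mathcal{T}$ as the poset (under inclusion) of vertex sets of its triangles and diagonals. The restriction maps $X_n\to X_I$ for $I\subseteq[n]$ induce the $2$-Segal map $f_{\mathcal{T}}\colon X_n\to\lim_{I\in\mathcal{T}}X_I$ of a simplicial set $X$, where $X_I\cong X_{|I|-1}$; the limit is the iterated fiber product of the sets $X_T$ ($T$ a triangle) over the sets $X_e$ ($e$ a diagonal). *)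

theory Defs
  imports "HOL-Analysis.Analysis" "HOL-Library.FuncSet"
begin

section \<open>Small categories\<close>

record ('o, 'm) precategory =
  Ob :: "'o set"
  Mor :: "'m set"
  Dom :: "'m \<Rightarrow> 'o"
  Cod :: "'m \<Rightarrow> 'o"
  Idm :: "'o \<Rightarrow> 'm"
  Comp :: "'m \<Rightarrow> 'm \<Rightarrow> 'm"  \<comment> \<open>\<open>Comp C g f\<close> is \<open>f\<close> followed by \<open>g\<close>\<close>

definition Hom :: "('o, 'm, 'z) precategory_scheme \<Rightarrow> 'o \<Rightarrow> 'o \<Rightarrow> 'm set" where
  "Hom C A B = {f \<in> Mor C. Dom C f = A \<and> Cod C f = B}"

locale category =
  fixes C :: "('o, 'm, 'z) precategory_scheme"
  assumes dom_in: "f \<in> Mor C \<Longrightarrow> Dom C f \<in> Ob C"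
    and cod_in: "f \<in> Mor C \<Longrightarrow> Cod C f \<in> Ob C"
    and id_in: "A \<in> Ob C \<Longrightarrow> Idm C A \<in> Hom C A A"
    and comp_in: "f \<in> Hom C A B \<Longrightarrow> g \<in> Hom C B D \<Longrightarrow> Comp C g f \<in> Hom C A D"
    and comp_id_right: "f \<in> Hom C A B \<Longrightarrow> Comp C f (Idm C A) = f"
    and comp_id_left: "f \<in> Hom C A B \<Longrightarrow> Comp C (Idm C B) f = f"
    and comp_assoc: "f \<in> Hom C A B \<Longrightarrow> g \<in> Hom C B D \<Longrightarrow> h \<in> Hom C D E \<Longrightarrow>
      Comp C h (Comp C g f) = Comp C (Comp C h g) f"

definition is_iso :: "('o, 'm, 'z) precategory_scheme \<Rightarrow> 'm \<Rightarrow> bool" where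
  "is_iso C f \<longleftrightarrow> f \<in> Mor C \<and>
     (\<exists>g \<in> Hom C (Cod C f) (Dom C f).
        Comp C g f = Idm C (Dom C f) \<and> Comp C f g = Idm C (Cod C f))"

definition iso_rel :: "('o, 'm, 'z) precategory_scheme \<Rightarrow> ('o \<times> 'o) set" where
  "iso_rel C = {(A, B). A \<in> Ob C \<and> B \<in> Ob C \<and> (\<exists>f \<in> Hom C A B. is_iso C f)}"

definition is_zero_object :: "('o, 'm, 'z) precategory_scheme \<Rightarrow> 'o \<Rightarrow> bool" where
  "is_zero_object C Z \<longleftrightarrow> Z \<in> Ob C \<and>
     (\<forall>A \<in> Ob C. (\<exists>!f. f \<in> Hom C Z A) \<and> (\<exists>!f. f \<in> Hom C A Z))"

text \<open>
  \<open>is_pushout C f g p q\<close>: the square with \<open>p \<circ> f = q \<circ> g\<close> is a pushout of the span \<open>f, g\<close>;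
  thus \<open>p\<close> starts at the target of \<open>f\<close>, and \<open>q\<close>, which starts at the target of \<open>g\<close>, is
  the cobase change of \<open>f\<close> along \<open>g\<close>.
\<close>

definition is_pushout :: "('o, 'm, 'z) precategory_scheme \<Rightarrow> 'm \<Rightarrow> 'm \<Rightarrow> 'm \<Rightarrow> 'm \<Rightarrow> bool" where
  "is_pushout C f g p q \<longleftrightarrow>
     f \<in> Mor C \<and> g \<in> Mor C \<and> p \<in> Mor C \<and> q \<in> Mor C \<and>
     Dom C f = Dom C g \<and> Dom C p = Cod C f \<and> Dom C q = Cod C g \<and> Cod C p = Cod C q \<and>
     Comp C p f = Comp C q g \<and>
     (\<forall>E. \<forall>u \<in> Hom C (Cod C f) E. \<forall>v \<in> Hom C (Cod C g) E. Comp C u f = Comp C v g \<longrightarrow>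
        (\<exists>!h. h \<in> Hom C (Cod C p) E \<and> Comp C h p = u \<and> Comp C h q = v))"


section \<open>Categories with cofibrations\<close>

text \<open>
  The zero object is part of the structure: it is the object \<open>0\<close> in \<open>A\<^sub>j\<^sub>j = 0\<close> below.

  HOL has no existential quantification over types, so existence statements use
  \<open>(nat, nat) cofcat\<close>, that is, countable categories with cofibrations. This loses
  nothing for the failure of surjectivity of the maps defined at the end: the axioms are first
  order, and a countable elementary substructure containing the finitely many diagrams and
  isomorphisms that witness the failure is again an example (downward Loewenheim-Skolem).
\<close>

record ('o, 'm) cofcat = "('o, 'm) precategory" +
  Zero :: 'o
  Cof :: "'m set"

locale category_with_cofibrations = category C
  for C :: "('o, 'm, 'z) cofcat_scheme" +
  assumes zero: "is_zero_object C (Zero C)"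
    and cof_mor: "Cof C \<subseteq> Mor C"
    and cof_zero: "A \<in> Ob C \<Longrightarrow> f \<in> Hom C (Zero C) A \<Longrightarrow> f \<in> Cof C"
    and cof_iso: "is_iso C f \<Longrightarrow> f \<in> Cof C"
    and cof_comp: "f \<in> Cof C \<Longrightarrow> g \<in> Cof C \<Longrightarrow> Cod C f = Dom C g \<Longrightarrow> Comp C g f \<in> Cof C"
    and cof_pushout_ex: "f \<in> Cof C \<Longrightarrow> g \<in> Mor C \<Longrightarrow> Dom C f = Dom C g \<Longrightarrow>
      \<exists>p q. is_pushout C f g p q"
    and cof_pushout: "f \<in> Cof C \<Longrightarrow> is_pushout C f g p q \<Longrightarrow> q \<in> Cof C"

definition is_cofibration_sequence :: "('o, 'm, 'z) cofcat_scheme \<Rightarrow> 'm \<Rightarrow> 'm \<Rightarrow> bool" where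
  "is_cofibration_sequence C f p \<longleftrightarrow> f \<in> Cof C \<and>
     (\<exists>z \<in> Hom C (Dom C f) (Zero C). \<exists>w \<in> Hom C (Zero C) (Cod C p). is_pushout C f z p w)"


section \<open>The construction \<open>S\<^sub>I\<close>\<close>

definition Ar :: "nat set \<Rightarrow> (nat \<times> nat) set" where
  "Ar I = {(i, j). i \<in> I \<and> j \<in> I \<and> i \<le> j}"

definition Ar_rel :: "nat set \<Rightarrow> ((nat \<times> nat) \<times> (nat \<times> nat)) set" where
  "Ar_rel I = {(p, q). p \<in> Ar I \<and> q \<in> Ar I \<and> fst p \<le> fst q \<and> snd p \<le> snd q}"

text \<open>
  A functor on the poset \<open>Ar I\<close> is a pair of its object part and its morphism part; the
  latter takes a relation \<open>p \<le> q\<close>, given as the pair \<open>(p, q)\<close>. Both parts are extensional, so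
  that functors are equal iff they agree on \<open>Ar I\<close>.
\<close>

type_synonym ('o, 'm) diagram =
  "(nat \<times> nat \<Rightarrow> 'o) \<times> ((nat \<times> nat) \<times> (nat \<times> nat) \<Rightarrow> 'm)"

definition is_functor :: "('o, 'm, 'z) precategory_scheme \<Rightarrow> nat set \<Rightarrow> ('o, 'm) diagram \<Rightarrow> bool" where
  "is_functor C I A \<longleftrightarrow>
     fst A \<in> Ar I \<rightarrow>\<^sub>E Ob C \<and> snd A \<in> extensional (Ar_rel I) \<and>
     (\<forall>(p, q) \<in> Ar_rel I. snd A (p, q) \<in> Hom C (fst A p) (fst A q)) \<and>
     (\<forall>p \<in> Ar I. snd A (p, p) = Idm C (fst A p)) \<and>
     (\<forall>p q r. (p, q) \<in> Ar_rel I \<longrightarrow> (q, r) \<in> Ar_rel I \<longrightarrow>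
        snd A (p, r) = Comp C (snd A (q, r)) (snd A (p, q)))"

definition S_ob :: "('o, 'm, 'z) cofcat_scheme \<Rightarrow> nat set \<Rightarrow> ('o, 'm) diagram set" where
  "S_ob C I = {A. is_functor C I A \<and>
     (\<forall>j \<in> I. fst A (j, j) = Zero C) \<and>
     (\<forall>i \<in> I. \<forall>j \<in> I. \<forall>k \<in> I. i < j \<longrightarrow> j < k \<longrightarrow>
        is_cofibration_sequence C (snd A ((i, j), (i, k))) (snd A ((i, k), (j, k))))}"

definition is_nat_trans ::
  "('o, 'm, 'z) precategory_scheme \<Rightarrow> nat set \<Rightarrow> ('o, 'm) diagram \<Rightarrow> ('o, 'm) diagram \<Rightarrow>
   (nat \<times> nat \<Rightarrow> 'm) \<Rightarrow> bool" where
  "is_nat_trans C I A B \<eta> \<longleftrightarrow>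
     \<eta> \<in> extensional (Ar I) \<and> (\<forall>p \<in> Ar I. \<eta> p \<in> Hom C (fst A p) (fst B p)) \<and>
     (\<forall>(p, q) \<in> Ar_rel I. Comp C (\<eta> q) (snd A (p, q)) = Comp C (snd B (p, q)) (\<eta> p))"

definition S_cat :: "('o, 'm, 'z) cofcat_scheme \<Rightarrow> nat set \<Rightarrow>
  (('o, 'm) diagram, ('o, 'm) diagram \<times> ('o, 'm) diagram \<times> (nat \<times> nat \<Rightarrow> 'm)) precategory" where
  "S_cat C I =
    \<lparr>Ob = S_ob C I,
     Mor = {(A, B, \<eta>). A \<in> S_ob C I \<and> B \<in> S_ob C I \<and> is_nat_trans C I A B \<eta>},
     Dom = (\<lambda>(A, B, \<eta>). A),
     Cod = (\<lambda>(A, B, \<eta>). B),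
     Idm = (\<lambda>A. (A, A, \<lambda>p \<in> Ar I. Idm C (fst A p))),
     Comp = (\<lambda>(_, D, \<theta>) (A, _, \<eta>). (A, D, \<lambda>p \<in> Ar I. Comp C (\<theta> p) (\<eta> p)))\<rparr>"

text \<open>Precomposition with the map \<open>Ar J \<rightarrow> Ar I\<close> induced by a monotone map \<open>\<phi> : J \<rightarrow> I\<close>.\<close>

definition S_pull :: "nat set \<Rightarrow> (nat \<Rightarrow> nat) \<Rightarrow> ('o, 'm) diagram \<Rightarrow> ('o, 'm) diagram" where
  "S_pull J \<phi> A =
    (\<lambda>p \<in> Ar J. fst A (map_prod \<phi> \<phi> p),
     \<lambda>pq \<in> Ar_rel J. snd A (map_prod (map_prod \<phi> \<phi>) (map_prod \<phi> \<phi>) pq))"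


section \<open>Simplicial sets\<close>

text \<open>
  A simplicial set is given on all finite nonempty sets of natural numbers and monotone maps
  between them, a category equivalent to its full subcategory of the ordinals
  \<open>[n] = {0..n}\<close>. This supplies \<open>X\<^sub>I\<close> for \<open>I \<subseteq> [n]\<close> directly. A monotone map
  \<open>\<phi> : J \<rightarrow> I\<close> acts as \<open>Act X J I \<phi> : Sim X I \<rightarrow> Sim X J\<close>.
\<close>

record 'x sset =
  Sim :: "nat set \<Rightarrow> 'x set"
  Act :: "nat set \<Rightarrow> nat set \<Rightarrow> (nat \<Rightarrow> nat) \<Rightarrow> 'x \<Rightarrow> 'x"

definition ordinal :: "nat set \<Rightarrow> bool" where
  "ordinal I \<longleftrightarrow> finite I \<and> I \<noteq> {}"

definition ordinal_map :: "nat set \<Rightarrow> nat set \<Rightarrow> (nat \<Rightarrow> nat) \<Rightarrow> bool" where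
  "ordinal_map J I \<phi> \<longleftrightarrow> ordinal J \<and> ordinal I \<and> \<phi> \<in> J \<rightarrow> I \<and> mono_on J \<phi>"

locale simplicial_set =
  fixes X :: "'x sset"
  assumes act_in: "ordinal_map J I \<phi> \<Longrightarrow> x \<in> Sim X I \<Longrightarrow> Act X J I \<phi> x \<in> Sim X J"
    and act_cong: "ordinal_map J I \<phi> \<Longrightarrow> x \<in> Sim X I \<Longrightarrow> (\<And>j. j \<in> J \<Longrightarrow> \<phi> j = \<psi> j) \<Longrightarrow>
      Act X J I \<phi> x = Act X J I \<psi> x"
    and act_id: "ordinal I \<Longrightarrow> x \<in> Sim X I \<Longrightarrow> Act X I I id x = x"
    and act_comp: "ordinal_map J I \<phi> \<Longrightarrow> ordinal_map K J \<psi> \<Longrightarrow> x \<in> Sim X I \<Longrightarrow>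
      Act X K I (\<phi> \<circ> \<psi>) x = Act X K J \<psi> (Act X J I \<phi> x)"

text \<open>
  The simplicial set of isomorphism classes. The class of \<open>A\<close> is sent to the class of its
  pullback, written as the set of all objects isomorphic to the pullback of some member.
\<close>

definition iso_s :: "('o, 'm, 'z) cofcat_scheme \<Rightarrow> ('o, 'm) diagram set sset" where
  "iso_s C =
    \<lparr>Sim = (\<lambda>I. Ob (S_cat C I) // iso_rel (S_cat C I)),
     Act = (\<lambda>J I \<phi> c. iso_rel (S_cat C J) `` (S_pull J \<phi> ` c))\<rparr>"


section \<open>Triangulations of polygons and the maps they induce\<close>

definition polygon_vertex :: "nat \<Rightarrow> nat \<Rightarrow> complex" where
  "polygon_vertex n k = cis (2 * pi * real k / real (n + 1))"

definition polygon_hull :: "nat \<Rightarrow> nat set \<Rightarrow> complex set" where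
  "polygon_hull n I = convex hull (polygon_vertex n ` I)"

text \<open>A triangulation of \<open>P\<^sub>n\<close> is represented by the set of vertex sets of its triangles.\<close>

definition is_triangulation :: "nat \<Rightarrow> nat set set \<Rightarrow> bool" where
  "is_triangulation n T \<longleftrightarrow>
     (\<forall>t \<in> T. t \<subseteq> {0..n} \<and> card t = 3) \<and>
     (\<Union>t \<in> T. polygon_hull n t) = polygon_hull n {0..n} \<and>
     (\<forall>s \<in> T. \<forall>t \<in> T. s \<noteq> t \<longrightarrow>
        polygon_hull n s \<inter> polygon_hull n t = {} \<or>
        (polygon_hull n s \<inter> polygon_hull n t face_of polygon_hull n s \<and>
         polygon_hull n s \<inter> polygon_hull n t face_of polygon_hull n t))"

definition polygon_edges :: "nat \<Rightarrow> nat set set" where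
  "polygon_edges n = {{k, (k + 1) mod (n + 1)} | k. k \<le> n}"

definition diagonals :: "nat \<Rightarrow> nat set set \<Rightarrow> nat set set" where
  "diagonals n T = {e. card e = 2 \<and> (\<exists>t \<in> T. e \<subseteq> t) \<and> e \<notin> polygon_edges n}"

definition cells :: "nat \<Rightarrow> nat set set \<Rightarrow> nat set set" where
  "cells n T = T \<union> diagonals n T"

definition segal_limit :: "'x sset \<Rightarrow> nat \<Rightarrow> nat set set \<Rightarrow> (nat set \<Rightarrow> 'x) set" where
  "segal_limit X n T = {x \<in> Pi\<^sub>E (cells n T) (Sim X).
     \<forall>I \<in> cells n T. \<forall>J \<in> cells n T. I \<subseteq> J \<longrightarrow> Act X I J id (x J) = x I}"

definition segal_map :: "'x sset \<Rightarrow> nat \<Rightarrow> nat set set \<Rightarrow> 'x \<Rightarrow> (nat set \<Rightarrow> 'x)" where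
  "segal_map X n T x = (\<lambda>I \<in> cells n T. Act X I {0..n} id x)"

text \<open>
  The next facts are sanity checks: \<open>S_cat C I\<close> is a category, \<open>iso_s C\<close> is a
  simplicial set, and the map of a triangulation takes values in the limit.
\<close>

lemma Hom_iff: "f \<in> Hom C A B \<longleftrightarrow> f \<in> Mor C \<and> Dom C f = A \<and> Cod C f = B"
  by (simp add: Hom_def)

lemma (in simplicial_set) segal_map_in_limit:
  assumes T: "is_triangulation n T" and x: "x \<in> Sim X {0..n}"
  shows "segal_map X n T x \<in> segal_limit X n T"
proof -
  have sub: "I \<subseteq> {0..n} \<and> ordinal I" if "I \<in> cells n T" for I
    using that T unfolding cells_def diagonals_def is_triangulation_def ordinal_def
    by (fastforce intro: finite_subset[of _ "{0..n}"])
  have mm: "ordinal_map I J id" if "I \<subseteq> J" "ordinal I" "ordinal J" for I J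
    using that by (auto simp: ordinal_map_def mono_on_def)
  have n: "ordinal {0..n}" by (simp add: ordinal_def)
  have "Act X I J id (Act X J {0..n} id x) = Act X I {0..n} id x"
    if "I \<in> cells n T" "J \<in> cells n T" "I \<subseteq> J" for I J
    using act_comp[OF mm[of J "{0..n}"] mm[of I J] x] sub that n by simp
  then show ?thesis
    using sub mm n x unfolding segal_limit_def segal_map_def
    by (auto intro!: act_in)
qed

lemma (in category) iso_relE:
  assumes "(A, B) \<in> iso_rel C"
  obtains f g where "A \<in> Ob C" "B \<in> Ob C" "f \<in> Hom C A B" "g \<in> Hom C B A"
    "Comp C g f = Idm C A" "Comp C f g = Idm C B"
  using assms by (auto simp: iso_rel_def is_iso_def Hom_def)

lemma (in category) iso_relI:
  assumes "f \<in> Hom C A B" "g \<in> Hom C B A" "Comp C g f = Idm C A" "Comp C f g = Idm C B"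
  shows "(A, B) \<in> iso_rel C"
proof -
  have "A \<in> Ob C" "B \<in> Ob C" using assms(1) dom_in cod_in by (auto simp: Hom_def)
  moreover have "is_iso C f" using assms by (metis is_iso_def Hom_iff)
  ultimately show ?thesis using assms(1) by (auto simp: iso_rel_def)
qed

lemma (in category) equiv_iso_rel: "equiv (Ob C) (iso_rel C)"
proof (rule equivI)
  show "iso_rel C \<subseteq> Ob C \<times> Ob C"
    by (auto simp: iso_rel_def)
  show "refl_on (Ob C) (iso_rel C)"
    by (simp add: refl_on_def iso_relI[OF id_in id_in comp_id_left[OF id_in] comp_id_left[OF id_in]])
  show "sym (iso_rel C)"
  proof (rule symI)
    fix A B assume "(A, B) \<in> iso_rel C"
    then show "(B, A) \<in> iso_rel C" by (rule iso_relE) (rule iso_relI)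
  qed
  show "trans (iso_rel C)"
  proof (rule transI)
    fix A B D assume "(A, B) \<in> iso_rel C" "(B, D) \<in> iso_rel C"
    obtain f g where 1: "f \<in> Hom C A B" "g \<in> Hom C B A" "Comp C g f = Idm C A" "Comp C f g = Idm C B"
      using \<open>(A, B) \<in> iso_rel C\<close> by (rule iso_relE)
    obtain h k where 2: "h \<in> Hom C B D" "k \<in> Hom C D B" "Comp C k h = Idm C B" "Comp C h k = Idm C D"
      using \<open>(B, D) \<in> iso_rel C\<close> by (rule iso_relE)
    have "Comp C (Comp C g k) (Comp C h f) = Comp C g (Comp C (Comp C k h) f)"
      using comp_assoc[OF comp_in[OF 1(1) 2(1)] 2(2) 1(2)] comp_assoc[OF 1(1) 2(1) 2(2)] by simp
    then have 3: "Comp C (Comp C g k) (Comp C h f) = Idm C A"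
      using 1(3) 2(3) comp_id_left[OF 1(1)] by simp
    have "Comp C (Comp C h f) (Comp C g k) = Comp C h (Comp C (Comp C f g) k)"
      using comp_assoc[OF comp_in[OF 2(2) 1(2)] 1(1) 2(1)] comp_assoc[OF 2(2) 1(2) 1(1)] by simp
    then have 4: "Comp C (Comp C h f) (Comp C g k) = Idm C D"
      using 1(4) 2(4) comp_id_left[OF 2(2)] by simp
    show "(A, D) \<in> iso_rel C"
      by (rule iso_relI[OF comp_in[OF 1(1) 2(1)] comp_in[OF 2(2) 1(2)] 3 4])
  qed
qed

lemma Ar_relD: "(p, q) \<in> Ar_rel I \<Longrightarrow> p \<in> Ar I \<and> q \<in> Ar I"
  by (simp add: Ar_rel_def)

lemma is_nat_transD:
  assumes "is_nat_trans C I A B \<eta>"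
  shows "\<eta> \<in> extensional (Ar I)" "\<And>p. p \<in> Ar I \<Longrightarrow> \<eta> p \<in> Hom C (fst A p) (fst B p)"
    "\<And>p q. (p, q) \<in> Ar_rel I \<Longrightarrow>
      Comp C (\<eta> q) (snd A (p, q)) = Comp C (snd B (p, q)) (\<eta> p)"
  using assms by (auto simp: is_nat_trans_def)

lemma S_obD:
  assumes "A \<in> S_ob C I"
  shows "\<And>p. p \<in> Ar I \<Longrightarrow> fst A p \<in> Ob C"
    "\<And>p q. (p, q) \<in> Ar_rel I \<Longrightarrow> snd A (p, q) \<in> Hom C (fst A p) (fst A q)"
    "\<And>p. p \<in> Ar I \<Longrightarrow> snd A (p, p) = Idm C (fst A p)"
    "\<And>p q r. (p, q) \<in> Ar_rel I \<Longrightarrow> (q, r) \<in> Ar_rel I \<Longrightarrow>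
      snd A (p, r) = Comp C (snd A (q, r)) (snd A (p, q))"
    "\<And>j. j \<in> I \<Longrightarrow> fst A (j, j) = Zero C"
    "\<And>i j k. i \<in> I \<Longrightarrow> j \<in> I \<Longrightarrow> k \<in> I \<Longrightarrow> i < j \<Longrightarrow> j < k \<Longrightarrow>
      is_cofibration_sequence C (snd A ((i, j), (i, k))) (snd A ((i, k), (j, k)))"
    "fst A \<in> extensional (Ar I)" "snd A \<in> extensional (Ar_rel I)"
  using assms unfolding S_ob_def is_functor_def by (auto simp: PiE_def)

lemma ordinal_map_Ar:
  assumes "ordinal_map J I \<phi>"
  shows "p \<in> Ar J \<Longrightarrow> map_prod \<phi> \<phi> p \<in> Ar I"
    "(p, q) \<in> Ar_rel J \<Longrightarrow> (map_prod \<phi> \<phi> p, map_prod \<phi> \<phi> q) \<in> Ar_rel I"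
  using assms by (auto simp: ordinal_map_def Ar_def Ar_rel_def mono_on_def)

lemma ordinal_map_comp:
  assumes "ordinal_map J I \<phi>" "ordinal_map K J \<psi>"
  shows "ordinal_map K I (\<phi> \<circ> \<psi>)"
proof -
  have "\<phi> (\<psi> i) \<le> \<phi> (\<psi> j)" if "i \<in> K" "j \<in> K" "i \<le> j" for i j
  proof -
    have "\<psi> i \<in> J" "\<psi> j \<in> J" "\<psi> i \<le> \<psi> j"
      using assms(2) that unfolding ordinal_map_def by (blast dest: mono_onD)+
    then show ?thesis
      using assms(1) unfolding ordinal_map_def by (blast dest: mono_onD)
  qed
  then show ?thesis
    using assms unfolding ordinal_map_def by (fastforce intro!: mono_onI)
qed

lemma S_pull_comp:
  assumes "ordinal_map K J \<psi>"
  shows "S_pull K (\<phi> \<circ> \<psi>) A = S_pull K \<psi> (S_pull J \<phi> A)"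
proof -
  have "fst A (map_prod (\<phi> \<circ> \<psi>) (\<phi> \<circ> \<psi>) p) = fst (S_pull J \<phi> A) (map_prod \<psi> \<psi> p)"
    if "p \<in> Ar K" for p
    using ordinal_map_Ar(1)[OF assms that] by (cases p) (simp add: S_pull_def)
  moreover have "snd A (map_prod (map_prod (\<phi> \<circ> \<psi>) (\<phi> \<circ> \<psi>)) (map_prod (\<phi> \<circ> \<psi>) (\<phi> \<circ> \<psi>)) pq) =
      snd (S_pull J \<phi> A) (map_prod (map_prod \<psi> \<psi>) (map_prod \<psi> \<psi>) pq)"
    if "pq \<in> Ar_rel K" for pq
    using ordinal_map_Ar(2)[OF assms, of "fst pq" "snd pq"] that
    by (cases pq) (auto simp: S_pull_def)
  ultimately show ?thesis
    unfolding S_pull_def[of K] by (simp cong: restrict_cong)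
qed

context category_with_cofibrations
begin

lemma nat_trans_id:
  assumes "A \<in> S_ob C I"
  shows "is_nat_trans C I A A (\<lambda>p \<in> Ar I. Idm C (fst A p))"
proof -
  note A = S_obD[OF assms]
  show ?thesis
    unfolding is_nat_trans_def
    using A(1) comp_id_left[OF A(2)] comp_id_right[OF A(2)]
    by (auto simp: id_in dest: Ar_relD)
qed

lemma nat_trans_comp:
  assumes "A \<in> S_ob C I" "B \<in> S_ob C I" "D \<in> S_ob C I"
    and "is_nat_trans C I A B \<eta>" "is_nat_trans C I B D \<theta>"
  shows "is_nat_trans C I A D (\<lambda>p \<in> Ar I. Comp C (\<theta> p) (\<eta> p))"
proof -
  note \<eta> = is_nat_transD[OF assms(4)] and \<theta> = is_nat_transD[OF assms(5)]
  have "Comp C (Comp C (\<theta> q) (\<eta> q)) (snd A (p, q)) = Comp C (snd D (p, q)) (Comp C (\<theta> p) (\<eta> p))"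
    if pq: "(p, q) \<in> Ar_rel I" for p q
  proof -
    have p: "p \<in> Ar I" and q: "q \<in> Ar I" using Ar_relD pq by blast+
    note m = S_obD(2)[OF assms(1) pq] S_obD(2)[OF assms(2) pq] S_obD(2)[OF assms(3) pq]
    have "Comp C (Comp C (\<theta> q) (\<eta> q)) (snd A (p, q)) = Comp C (\<theta> q) (Comp C (\<eta> q) (snd A (p, q)))"
      using comp_assoc[OF m(1) \<eta>(2)[OF q] \<theta>(2)[OF q]] by simp
    also have "\<dots> = Comp C (Comp C (\<theta> q) (snd B (p, q))) (\<eta> p)"
      using comp_assoc[OF \<eta>(2)[OF p] m(2) \<theta>(2)[OF q]] \<eta>(3)[OF pq] by simp
    also have "\<dots> = Comp C (snd D (p, q)) (Comp C (\<theta> p) (\<eta> p))"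
      using comp_assoc[OF \<eta>(2)[OF p] \<theta>(2)[OF p] m(3)] \<theta>(3)[OF pq] by simp
    finally show ?thesis .
  qed
  then show ?thesis
    using comp_in[OF \<eta>(2) \<theta>(2)] by (auto simp: is_nat_trans_def dest: Ar_relD)
qed

lemma category_S_cat: "category (S_cat C I)"
proof
  fix A assume "A \<in> Ob (S_cat C I)"
  then show "Idm (S_cat C I) A \<in> Hom (S_cat C I) A A"
    by (auto simp: S_cat_def Hom_def nat_trans_id)
next
  fix f g A B D
  assume "f \<in> Hom (S_cat C I) A B" "g \<in> Hom (S_cat C I) B D"
  then show "Comp (S_cat C I) g f \<in> Hom (S_cat C I) A D"
    by (auto simp: S_cat_def Hom_def intro: nat_trans_comp)
next
  fix f A B assume "f \<in> Hom (S_cat C I) A B"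
  then obtain \<eta> where f: "f = (A, B, \<eta>)" and \<eta>: "is_nat_trans C I A B \<eta>"
    by (auto simp: S_cat_def Hom_def)
  have "(\<lambda>p \<in> Ar I. Comp C (\<eta> p) ((\<lambda>p \<in> Ar I. Idm C (fst A p)) p)) = \<eta>"
    "(\<lambda>p \<in> Ar I. Comp C ((\<lambda>p \<in> Ar I. Idm C (fst B p)) p) (\<eta> p)) = \<eta>"
    by (auto intro!: extensionalityI[OF _ is_nat_transD(1)[OF \<eta>]]
        comp_id_right[OF is_nat_transD(2)[OF \<eta>]] comp_id_left[OF is_nat_transD(2)[OF \<eta>]])
  then show "Comp (S_cat C I) f (Idm (S_cat C I) A) = f" "Comp (S_cat C I) (Idm (S_cat C I) B) f = f"
    by (simp_all add: S_cat_def f)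
next
  fix f g h A B D E
  assume "f \<in> Hom (S_cat C I) A B" "g \<in> Hom (S_cat C I) B D" "h \<in> Hom (S_cat C I) D E"
  then show "Comp (S_cat C I) h (Comp (S_cat C I) g f) = Comp (S_cat C I) (Comp (S_cat C I) h g) f"
    by (auto simp: S_cat_def Hom_def intro!: restrict_ext comp_assoc is_nat_transD(2))
qed (auto simp: S_cat_def)

lemma hom_zero_eq:
  "f \<in> Hom C (Zero C) A \<Longrightarrow> g \<in> Hom C (Zero C) A \<Longrightarrow> f = g"
  "f \<in> Hom C A (Zero C) \<Longrightarrow> g \<in> Hom C A (Zero C) \<Longrightarrow> f = g"
  using zero dom_in cod_in unfolding is_zero_object_def Hom_def by blast+

lemma zero_in: "Zero C \<in> Ob C"
  using zero by (simp add: is_zero_object_def)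

lemma id_cof: "A \<in> Ob C \<Longrightarrow> Idm C A \<in> Cof C"
  using id_in[of A] comp_id_left[OF id_in[of A]] by (auto intro!: cof_iso simp: is_iso_def Hom_def)

lemma cofibration_sequence_zero_left:
  assumes "f \<in> Hom C (Zero C) A"
  shows "is_cofibration_sequence C f (Idm C A)"
proof -
  have A: "A \<in> Ob C" using assms cod_in by (auto simp: Hom_def)
  have "\<forall>E. \<forall>u \<in> Hom C A E. \<forall>v \<in> Hom C (Zero C) E.
      \<exists>!h. h \<in> Hom C A E \<and> Comp C h (Idm C A) = u \<and> Comp C h f = v"
    using comp_in[OF assms] comp_id_right hom_zero_eq(1) by metis
  moreover have "Comp C (Idm C A) f = f" "Comp C f (Idm C (Zero C)) = f"
    using assms comp_id_left comp_id_right by auto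
  ultimately have "is_pushout C f (Idm C (Zero C)) (Idm C A) f"
    using assms A id_in zero_in unfolding is_pushout_def Hom_def by simp
  then show ?thesis
    using assms cof_zero[OF A assms] id_in[OF zero_in] id_in[OF A]
    unfolding is_cofibration_sequence_def by (metis Hom_iff)
qed

lemma cofibration_sequence_zero_right:
  assumes "g \<in> Hom C A (Zero C)"
  shows "is_cofibration_sequence C (Idm C A) g"
proof -
  have A: "A \<in> Ob C" using assms dom_in by (auto simp: Hom_def)
  have "\<forall>E. \<forall>u \<in> Hom C A E. \<forall>v \<in> Hom C (Zero C) E. Comp C u (Idm C A) = Comp C v g \<longrightarrow>
      (\<exists>!h. h \<in> Hom C (Zero C) E \<and> Comp C h g = u \<and> Comp C h (Idm C (Zero C)) = v)"
    using comp_id_right by metis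
  moreover have "Comp C (Idm C (Zero C)) g = g" "Comp C g (Idm C A) = g"
    using assms comp_id_left comp_id_right by auto
  ultimately have "is_pushout C (Idm C A) g g (Idm C (Zero C))"
    using assms A id_in zero_in unfolding is_pushout_def Hom_def by simp
  then show ?thesis
    using assms id_cof[OF A] id_in[OF zero_in] id_in[OF A]
    unfolding is_cofibration_sequence_def by (metis Hom_iff)
qed

lemma S_ob_cofibration_sequence:
  assumes A: "A \<in> S_ob C I" and I: "i \<in> I" "j \<in> I" "k \<in> I" "i \<le> j" "j \<le> k"
  shows "is_cofibration_sequence C (snd A ((i, j), (i, k))) (snd A ((i, k), (j, k)))"
proof -
  note A' = S_obD[OF A]
  have ar: "((i, j), (i, k)) \<in> Ar_rel I" "((i, k), (j, k)) \<in> Ar_rel I" "(i, k) \<in> Ar I" "(i, j) \<in> Ar I"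
    using I by (auto simp: Ar_rel_def Ar_def)
  consider "i < j" "j < k" | "i = j" | "j = k" using I by linarith
  then show ?thesis
  proof cases
    case 1 then show ?thesis using A'(6) I by blast
  next
    case 2 then show ?thesis
      using A'(2)[OF ar(1)] A'(3)[OF ar(3)] A'(5)[OF I(1)] by (simp add: cofibration_sequence_zero_left)
  next
    case 3 then show ?thesis
      using A'(2)[OF ar(2)] A'(3)[OF ar(3)] A'(5)[OF I(2)] by (simp add: cofibration_sequence_zero_right)
  qed
qed

lemma S_pull_in:
  assumes \<phi>: "ordinal_map J I \<phi>" and A: "A \<in> S_ob C I"
  shows "S_pull J \<phi> A \<in> S_ob C J"
proof -
  note A' = S_obD[OF A] and m = ordinal_map_Ar[OF \<phi>]
  have j: "\<phi> j \<in> I" if "j \<in> J" for j using \<phi> that by (auto simp: ordinal_map_def)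
  have le: "\<phi> i \<le> \<phi> j" if "i \<in> J" "j \<in> J" "i \<le> j" for i j
    using \<phi> that by (auto simp: ordinal_map_def mono_on_def)
  have r: "(p, r) \<in> Ar_rel J" if "(p, q) \<in> Ar_rel J" "(q, r) \<in> Ar_rel J" for p q r
    using that by (auto simp: Ar_rel_def)
  have "is_functor C J (S_pull J \<phi> A)"
    unfolding is_functor_def S_pull_def fst_conv snd_conv
  proof (intro conjI ballI allI impI)
    show "(\<lambda>p \<in> Ar J. fst A (map_prod \<phi> \<phi> p)) \<in> Ar J \<rightarrow>\<^sub>E Ob C"
      using A'(1) m(1) by auto
  next
    fix x assume "x \<in> Ar_rel J"
    then show "case x of (p, q) \<Rightarrow>
        (\<lambda>pq \<in> Ar_rel J. snd A (map_prod (map_prod \<phi> \<phi>) (map_prod \<phi> \<phi>) pq)) (p, q)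
        \<in> Hom C ((\<lambda>p \<in> Ar J. fst A (map_prod \<phi> \<phi> p)) p) ((\<lambda>p \<in> Ar J. fst A (map_prod \<phi> \<phi> p)) q)"
      using A'(2)[OF m(2)] by (cases x) (auto dest: Ar_relD)
  next
    fix p assume p: "p \<in> Ar J"
    then have "(p, p) \<in> Ar_rel J" by (simp add: Ar_rel_def)
    with p show "(\<lambda>pq \<in> Ar_rel J. snd A (map_prod (map_prod \<phi> \<phi>) (map_prod \<phi> \<phi>) pq)) (p, p) =
        Idm C ((\<lambda>p \<in> Ar J. fst A (map_prod \<phi> \<phi> p)) p)"
      using A'(3)[OF m(1)[OF p]] by simp
  next
    fix p q s assume pq: "(p, q) \<in> Ar_rel J" "(q, s) \<in> Ar_rel J"
    show "(\<lambda>pq \<in> Ar_rel J. snd A (map_prod (map_prod \<phi> \<phi>) (map_prod \<phi> \<phi>) pq)) (p, s) =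
        Comp C ((\<lambda>pq \<in> Ar_rel J. snd A (map_prod (map_prod \<phi> \<phi>) (map_prod \<phi> \<phi>) pq)) (q, s))
          ((\<lambda>pq \<in> Ar_rel J. snd A (map_prod (map_prod \<phi> \<phi>) (map_prod \<phi> \<phi>) pq)) (p, q))"
      using A'(4)[OF m(2)[OF pq(1)] m(2)[OF pq(2)]] r[OF pq] pq by simp
  qed simp
  moreover have "fst (S_pull J \<phi> A) (i, i) = Zero C" if "i \<in> J" for i
    using A'(5)[OF j[OF that]] that by (simp add: S_pull_def Ar_def)
  moreover have "is_cofibration_sequence C (snd (S_pull J \<phi> A) ((i, k), (i, l)))
      (snd (S_pull J \<phi> A) ((i, l), (k, l)))"
    if "i \<in> J" "k \<in> J" "l \<in> J" "i < k" "k < l" for i k l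
    using S_ob_cofibration_sequence[OF A j j j le le, of i k l] that
    by (simp add: S_pull_def Ar_rel_def Ar_def)
  ultimately show ?thesis by (simp add: S_ob_def)
qed

lemma S_pull_iso:
  assumes \<phi>: "ordinal_map J I \<phi>" and AB: "(A, B) \<in> iso_rel (S_cat C I)"
  shows "(S_pull J \<phi> A, S_pull J \<phi> B) \<in> iso_rel (S_cat C J)"
proof -
  note m = ordinal_map_Ar[OF \<phi>]
  define R where "R \<eta> = (\<lambda>p \<in> Ar J. \<eta> (map_prod \<phi> \<phi> p))" for \<eta> :: "nat \<times> nat \<Rightarrow> 'm"
  have R: "is_nat_trans C J (S_pull J \<phi> A) (S_pull J \<phi> B) (R \<eta>)"
    if "is_nat_trans C I A B \<eta>" for A B \<eta>
    using is_nat_transD(2,3)[OF that] m unfolding is_nat_trans_def R_def S_pull_def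
    by (auto dest: Ar_relD)
  from AB obtain f g where A: "A \<in> S_ob C I" and B: "B \<in> S_ob C I"
    and f: "f \<in> Hom (S_cat C I) A B" and g: "g \<in> Hom (S_cat C I) B A"
    and gf: "Comp (S_cat C I) g f = Idm (S_cat C I) A"
    and fg: "Comp (S_cat C I) f g = Idm (S_cat C I) B"
    by (rule category.iso_relE[OF category_S_cat]) (auto simp: S_cat_def)
  obtain \<eta> where \<eta>: "f = (A, B, \<eta>)" "is_nat_trans C I A B \<eta>"
    using f by (auto simp: S_cat_def Hom_def)
  obtain \<theta> where \<theta>: "g = (B, A, \<theta>)" "is_nat_trans C I B A \<theta>"
    using g by (auto simp: S_cat_def Hom_def)
  have 1: "Comp C (\<theta> p) (\<eta> p) = Idm C (fst A p)" "Comp C (\<eta> p) (\<theta> p) = Idm C (fst B p)"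
    if "p \<in> Ar I" for p
    using gf fg that by (auto simp: \<eta> \<theta> S_cat_def dest!: fun_cong[where x = p])
  show ?thesis
  proof (rule category.iso_relI[OF category_S_cat])
    show "(S_pull J \<phi> A, S_pull J \<phi> B, R \<eta>) \<in> Hom (S_cat C J) (S_pull J \<phi> A) (S_pull J \<phi> B)"
      "(S_pull J \<phi> B, S_pull J \<phi> A, R \<theta>) \<in> Hom (S_cat C J) (S_pull J \<phi> B) (S_pull J \<phi> A)"
      using R \<eta> \<theta> S_pull_in[OF \<phi>] A B by (auto simp: S_cat_def Hom_def)
    have "Comp C (R \<theta> p) (R \<eta> p) = Idm C (fst (S_pull J \<phi> A) p)"
      "Comp C (R \<eta> p) (R \<theta> p) = Idm C (fst (S_pull J \<phi> B) p)" if "p \<in> Ar J" for p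
      using 1[OF m(1)[OF that]] that by (simp_all add: R_def S_pull_def)
    then show "Comp (S_cat C J) (S_pull J \<phi> B, S_pull J \<phi> A, R \<theta>) (S_pull J \<phi> A, S_pull J \<phi> B, R \<eta>) =
        Idm (S_cat C J) (S_pull J \<phi> A)"
      "Comp (S_cat C J) (S_pull J \<phi> A, S_pull J \<phi> B, R \<eta>) (S_pull J \<phi> B, S_pull J \<phi> A, R \<theta>) =
        Idm (S_cat C J) (S_pull J \<phi> B)"
      by (simp_all add: S_cat_def cong: restrict_cong)
  qed
qed

lemma iso_s_act:
  assumes \<phi>: "ordinal_map J I \<phi>" and A: "A \<in> S_ob C I"
  shows "Act (iso_s C) J I \<phi> (iso_rel (S_cat C I) `` {A}) = iso_rel (S_cat C J) `` {S_pull J \<phi> A}"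
proof -
  note eI = category.equiv_iso_rel[OF category_S_cat, of I]
    and eJ = category.equiv_iso_rel[OF category_S_cat, of J]
  have "A \<in> iso_rel (S_cat C I) `` {A}"
    using equiv_class_self[OF eI] A by (simp add: S_cat_def)
  moreover have "iso_rel (S_cat C J) `` {S_pull J \<phi> B} = iso_rel (S_cat C J) `` {S_pull J \<phi> A}"
    if "B \<in> iso_rel (S_cat C I) `` {A}" for B
    using equiv_class_eq[OF eJ S_pull_iso[OF \<phi>]] that by auto
  ultimately have "(\<Union>B \<in> iso_rel (S_cat C I) `` {A}. iso_rel (S_cat C J) `` {S_pull J \<phi> B}) =
      iso_rel (S_cat C J) `` {S_pull J \<phi> A}"
    by (intro UN_constant_eq ballI)
  moreover have "iso_rel (S_cat C J) `` (S_pull J \<phi> ` (iso_rel (S_cat C I) `` {A})) =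
      (\<Union>B \<in> iso_rel (S_cat C I) `` {A}. iso_rel (S_cat C J) `` {S_pull J \<phi> B})"
    by (subst Image_eq_UN) (simp only: UN_simps)
  ultimately show ?thesis by (simp add: iso_s_def)
qed

lemma iso_s_simE:
  assumes "x \<in> Sim (iso_s C) I"
  obtains A where "A \<in> S_ob C I" "x = iso_rel (S_cat C I) `` {A}"
  using assms by (auto simp: iso_s_def S_cat_def elim!: quotientE)

lemma iso_s_simI: "A \<in> S_ob C I \<Longrightarrow> iso_rel (S_cat C I) `` {A} \<in> Sim (iso_s C) I"
  by (auto simp: iso_s_def S_cat_def intro!: quotientI)

lemma simplicial_set_iso_s: "simplicial_set (iso_s C)"
proof
  fix J I \<phi> and x :: "('o, 'm) diagram set"
  assume \<phi>: "ordinal_map J I \<phi>" and x: "x \<in> Sim (iso_s C) I"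
  obtain A where A: "A \<in> S_ob C I" "x = iso_rel (S_cat C I) `` {A}" using x by (rule iso_s_simE)
  show "Act (iso_s C) J I \<phi> x \<in> Sim (iso_s C) J"
    using iso_s_act[OF \<phi> A(1)] iso_s_simI[OF S_pull_in[OF \<phi> A(1)]] A(2) by simp
next
  fix J I :: "nat set" and \<phi> \<psi> :: "nat \<Rightarrow> nat" and x :: "('o, 'm) diagram set"
  assume eq: "\<And>j. j \<in> J \<Longrightarrow> \<phi> j = \<psi> j"
  have "S_pull J \<phi> B = S_pull J \<psi> B" for B :: "('o, 'm) diagram"
    unfolding S_pull_def using eq
    by (auto intro!: restrict_ext simp: Ar_def Ar_rel_def)
  then have "S_pull J \<phi> = (S_pull J \<psi> :: ('o, 'm) diagram \<Rightarrow> _)" by blast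
  then show "Act (iso_s C) J I \<phi> x = Act (iso_s C) J I \<psi> x"
    by (simp add: iso_s_def)
next
  fix J I K \<phi> \<psi> and x :: "('o, 'm) diagram set"
  assume \<phi>: "ordinal_map J I \<phi>" and \<psi>: "ordinal_map K J \<psi>" and x: "x \<in> Sim (iso_s C) I"
  obtain A where A: "A \<in> S_ob C I" "x = iso_rel (S_cat C I) `` {A}" using x by (rule iso_s_simE)
  have "S_pull K (\<phi> \<circ> \<psi>) A = S_pull K \<psi> (S_pull J \<phi> A)"
    by (rule S_pull_comp[OF \<psi>])
  then show "Act (iso_s C) K I (\<phi> \<circ> \<psi>) x = Act (iso_s C) K J \<psi> (Act (iso_s C) J I \<phi> x)"
    using A iso_s_act[OF \<phi> A(1)] iso_s_act[OF ordinal_map_comp[OF \<phi> \<psi>] A(1)]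
      iso_s_act[OF \<psi> S_pull_in[OF \<phi> A(1)]] by simp
next
  fix I and x :: "('o, 'm) diagram set"
  assume I: "ordinal I" and x: "x \<in> Sim (iso_s C) I"
  obtain A where A: "A \<in> S_ob C I" "x = iso_rel (S_cat C I) `` {A}" using x by (rule iso_s_simE)
  have i: "ordinal_map I I id" using I by (auto simp: ordinal_map_def mono_on_def)
  have "S_pull I id A = A"
    using S_obD(7,8)[OF A(1)] by (auto simp: S_pull_def prod.map_id0 extensional_restrict prod_eq_iff)
  then show "Act (iso_s C) I I id x = x"
    using iso_s_act[OF i A(1)] A(2) by simp
qed

end

end

theory Submission
  imports Defs
begin

text \<open>
  Some triangle without the vertex \<open>0\<close> has a neighbour containing it: if \<open>{i, j, k}\<close> with
  \<open>0 < i < j < k\<close> is chosen with \<open>k - i\<close> maximal, the triangle on the other side of the chord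
  \<open>{i, k}\<close> must be \<open>{0, i, k}\<close>. As no triangle crosses this chord, any
  compatible pair of simplices on \<open>{0, i, k}\<close> and \<open>{i, j, k}\<close> extends to a point of the limit,
  by pulling back along monotone maps \<open>[n] \<rightarrow> [2]\<close> that collapse everything else.
  A lift would contain \<open>A\<^sub>0\<^sub>i \<rightarrowtail> A\<^sub>0\<^sub>j \<rightarrowtail> A\<^sub>0\<^sub>k\<close> whose quotient by \<open>A\<^sub>0\<^sub>i\<close> is the given
  \<open>A\<^sub>i\<^sub>j \<rightarrowtail> A\<^sub>i\<^sub>k\<close>, so it suffices to find cofibrations \<open>A \<rightarrowtail> B\<close> and \<open>D \<rightarrowtail> B/A\<close> such that
  \<open>D\<close> does not lift to a subobject of \<open>B\<close>.

  In the category of finite pointed sets with a pointed self-map, call an injection \<open>A \<rightarrow> B\<close> a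
  cofibration if every \<open>a \<noteq> 0\<close> in \<open>A\<close> has an even number of preimages, under the self-map
  of \<open>B\<close>, outside \<open>A\<close>. Take \<open>A = {0, a}\<close> and \<open>B = {0, a, d, d'}\<close> with
  \<open>d, d' \<mapsto> a \<mapsto> 0\<close>. Then \<open>B/A = {0, d, d'}\<close> has trivial self-map and contains
  \<open>D = {0, d}\<close>, but an object between \<open>A\<close> and \<open>B\<close> with quotient \<open>D\<close> has exactly one preimage
  of \<open>a\<close> outside \<open>A\<close>.
\<close>

section \<open>Triangulations of a regular polygon\<close>

text \<open>An angle beyond pi is reflected to \<open>2 * pi - d\<close>, which has the same cosine
  and lies where cosine is decreasing.\<close>

lemma cos_less_cos:
  assumes "0 \<le> h" "h < d" "d < 2 * pi - h"
  shows "cos d < cos h"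
proof (cases "d \<le> pi")
  case True
  then show ?thesis using assms by (intro cos_monotone_0_pi) auto
next
  case False
  then have "cos (2 * pi - d) < cos h" using assms by (intro cos_monotone_0_pi) auto
  then show ?thesis by (simp add: cos_diff)
qed

text \<open>
  The line through the vertices \<open>i\<close> and \<open>k\<close> is \<open>{z. chord_normal n i k \<bullet> z = chord_level n i k}\<close>;
  for \<open>i = k\<close> it is the tangent to the circle, which shows that vertices are extreme points.
\<close>

definition chord_normal :: "nat \<Rightarrow> nat \<Rightarrow> nat \<Rightarrow> complex" where
  "chord_normal n i k = cis (pi * real (i + k) / real (n + 1))"

definition chord_level :: "nat \<Rightarrow> nat \<Rightarrow> nat \<Rightarrow> real" where
  "chord_level n i k = cos (pi * (real k - real i) / real (n + 1))"

lemma inner_chord_normal: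
  "chord_normal n i k \<bullet> polygon_vertex n x = cos (pi * (2 * real x - real i - real k) / real (n + 1))"
proof -
  have "2 * pi * real x / real (n + 1) - pi * real (i + k) / real (n + 1)
      = pi * (2 * real x - real i - real k) / real (n + 1)"
    by (simp add: diff_divide_distrib[symmetric] right_diff_distrib distrib_left)
  then show ?thesis
    unfolding chord_normal_def polygon_vertex_def inner_complex_def
    by (simp add: cos_diff[symmetric] mult.commute)
      (metis cos_diff mult.commute)
qed

text \<open>Both sides are cosines, \<open>cos d\<close> and \<open>cos h\<close>: \<open>h\<close>
  is half the angle subtended by the chord and \<open>d\<close> the difference of the angles of
  \<open>x\<close> and of the normal, which is below \<open>h\<close> exactly on the arc strictly
  between \<open>i\<close> and \<open>k\<close>.\<close>

lemma chord_side:
  assumes "i \<le> k" "k \<le> n" "x \<le> n"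
  shows "i < x \<Longrightarrow> x < k \<Longrightarrow> chord_level n i k < chord_normal n i k \<bullet> polygon_vertex n x"
    and "x < i \<or> k < x \<Longrightarrow> chord_normal n i k \<bullet> polygon_vertex n x < chord_level n i k"
    and "x = i \<or> x = k \<Longrightarrow> chord_normal n i k \<bullet> polygon_vertex n x = chord_level n i k"
proof -
  define h where "h = pi * (real k - real i) / real (n + 1)"
  define d where "d = pi * \<bar>2 * real x - real i - real k\<bar> / real (n + 1)"
  have L: "chord_normal n i k \<bullet> polygon_vertex n x = cos d"
    unfolding inner_chord_normal d_def using cos_abs_real[of "pi * (2 * real x - real i - real k) / real (n + 1)"]
    by (simp add: abs_mult)
  have c: "chord_level n i k = cos h" by (simp add: chord_level_def h_def)
  have h0: "0 \<le> h" using assms by (simp add: h_def)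
  have d0: "0 \<le> d" by (simp add: d_def)
  have hd: "h < d \<longleftrightarrow> real k - real i < \<bar>2 * real x - real i - real k\<bar>"
    "d < h \<longleftrightarrow> \<bar>2 * real x - real i - real k\<bar> < real k - real i"
    "d = h \<longleftrightarrow> \<bar>2 * real x - real i - real k\<bar> = real k - real i"
    by (auto simp: h_def d_def divide_less_cancel)
  \<comment> \<open>As \<open>d\<close> may exceed pi, \<open>h < d\<close> alone does not give
    \<open>cos d < cos h\<close>; the bound on \<open>d + h\<close> keeps a vertex beyond the chord
    from wrapping around to the arc.\<close>
  have "d + h < 2 * pi" "h \<le> pi"
  proof -
    have "pi * (\<bar>2 * real x - real i - real k\<bar> + (real k - real i)) < pi * (2 * real (n + 1))"
      using assms by (intro mult_strict_left_mono) auto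
    then have "pi * (\<bar>2 * real x - real i - real k\<bar> + (real k - real i)) / real (n + 1) < 2 * pi"
      by (simp add: pos_divide_less_eq mult_ac)
    then show "d + h < 2 * pi"
      unfolding h_def d_def by (simp only: distrib_left add_divide_distrib)
    have "pi * (real k - real i) \<le> pi * real (n + 1)"
      using assms by (intro mult_left_mono) auto
    then show "h \<le> pi" unfolding h_def by (simp add: field_simps)
  qed
  note b = this
  show "chord_level n i k < chord_normal n i k \<bullet> polygon_vertex n x" if "i < x" "x < k"
    unfolding L c using that hd d0 b by (intro cos_monotone_0_pi) auto
  show "chord_normal n i k \<bullet> polygon_vertex n x < chord_level n i k" if "x < i \<or> k < x"
    unfolding L c using that hd h0 b assms by (intro cos_less_cos) auto
  show "chord_normal n i k \<bullet> polygon_vertex n x = chord_level n i k" if "x = i \<or> x = k"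
    unfolding L c using that hd(3) assms by auto
qed

lemma polygon_hull_halfspace:
  assumes "\<And>x. x \<in> I \<Longrightarrow> r \<le> v \<bullet> polygon_vertex n x" "z \<in> polygon_hull n I"
  shows "r \<le> v \<bullet> z"
proof -
  have "polygon_hull n I \<subseteq> {z. v \<bullet> z \<ge> r}"
    unfolding polygon_hull_def using assms(1) by (intro hull_minimal convex_halfspace_ge) auto
  then show ?thesis using assms(2) by auto
qed

text \<open>The open half plane inside the tangent at \<open>x\<close> contains every other vertex,
  hence the hull of any set of them, but not \<open>x\<close> itself.\<close>

lemma polygon_vertex_in_hull_iff:
  assumes "I \<subseteq> {0..n}" "x \<le> n"
  shows "polygon_vertex n x \<in> polygon_hull n I \<longleftrightarrow> x \<in> I"
proof
  assume h: "polygon_vertex n x \<in> polygon_hull n I"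
  show "x \<in> I"
  proof (rule ccontr)
    assume "x \<notin> I"
    have "polygon_hull n I \<subseteq> {z. chord_normal n x x \<bullet> z < chord_level n x x}"
      unfolding polygon_hull_def
    proof (intro hull_minimal convex_halfspace_lt subsetI, clarify)
      fix y assume "y \<in> I"
      then have "y \<noteq> x" using \<open>x \<notin> I\<close> by blast
      with \<open>y \<in> I\<close> show "chord_normal n x x \<bullet> polygon_vertex n y < chord_level n x x"
        using assms by (intro chord_side(2)) auto
    qed
    then show False using h chord_side(3)[of x x n x] assms by auto
  qed
qed (auto simp: polygon_hull_def intro: hull_inc)

lemma norm_polygon_hull_le:
  assumes "z \<in> polygon_hull n I"
  shows "norm z \<le> 1"
proof -
  have "polygon_hull n I \<subseteq> cball 0 1"
    unfolding polygon_hull_def by (intro hull_minimal convex_cball) (auto simp: polygon_vertex_def)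
  then show ?thesis using assms by auto
qed

text \<open>Rotation by the conjugate of the normal makes the line of the chord vertical, with real
  part \<open>cos h\<close>. Its points in the unit disc have imaginary part between
  \<open>- sin h\<close> and \<open>sin h\<close>, and these values belong to the two
  endpoints.\<close>

lemma chord_closed_segment:
  assumes "i < k" "k \<le> n" "norm q \<le> 1" "chord_normal n i k \<bullet> q = chord_level n i k"
  shows "q \<in> closed_segment (polygon_vertex n i) (polygon_vertex n k)"
proof -
  define h where "h = pi * (real k - real i) / real (n + 1)"
  define u where "u = chord_normal n i k"
  define w where "w = cnj u * q"
  have u: "u * cnj u = 1" "cnj u * u = 1" by (simp_all add: u_def chord_normal_def cis_cnj cis_mult)
  have q: "q = u * w" using u by (simp add: w_def mult.assoc[symmetric])
  have "pi * (real k - real i) < pi * real (n + 1)"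
    using assms by (intro mult_strict_left_mono) auto
  then have "0 < h" "h < pi" using assms by (simp_all add: h_def field_simps)
  then have s: "sin h > 0" by (rule sin_gt_zero)
  have "Re w = u \<bullet> q" by (simp add: w_def inner_complex_def)
  then have re: "Re w = cos h" using assms(4) by (simp add: u_def chord_level_def h_def)
  have "norm w = norm q" by (simp add: w_def norm_mult u_def chord_normal_def)
  then have "(Re w)\<^sup>2 + (Im w)\<^sup>2 \<le> 1" using assms(3) by (simp add: norm_complex_def)
  then have "(Im w)\<^sup>2 \<le> (sin h)\<^sup>2" using re by (simp add: sin_squared_eq)
  then have im: "- sin h \<le> Im w" "Im w \<le> sin h" using s abs_le_square_iff[of "Im w" "sin h"] by auto
  \<comment> \<open>The range of \<open>Im w\<close> is rescaled to the unit interval, so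
    \<open>t\<close> is the coordinate along the chord.\<close>
  define t where "t = (Im w + sin h) / (2 * sin h)"
  have t: "0 \<le> t" "t \<le> 1" using im s by (auto simp: t_def field_simps)
  have "(2 * t - 1) * sin h = Im w" using s by (simp add: t_def field_simps)
  then have w: "w = (1 - t) *\<^sub>R cis (- h) + t *\<^sub>R cis h"
    using re by (simp add: complex_eq_iff algebra_simps)
  have v: "polygon_vertex n i = u * cis (- h)" "polygon_vertex n k = u * cis h"
    unfolding u_def chord_normal_def polygon_vertex_def cis_mult h_def
    by (simp_all add: add_divide_distrib[symmetric] diff_divide_distrib[symmetric] algebra_simps)
  have "q = (1 - t) *\<^sub>R polygon_vertex n i + t *\<^sub>R polygon_vertex n k"
    unfolding q v by (subst w) (simp add: algebra_simps)
  then show ?thesis using t unfolding closed_segment_def by blast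
qed

text \<open>The affine function vanishing on the line through \<open>i\<close> and \<open>k\<close>
  changes sign between \<open>a\<close> and \<open>b\<close>, so their segment meets this line. The
  meeting point lies in the unit disc, hence on the chord, and it is not an endpoint because
  vertices are extreme.\<close>

lemma chords_cross:
  assumes "i < a" "a < k" "k \<le> n" "b \<le> n" "b < i \<or> k < b"
  shows "\<exists>q \<in> polygon_hull n {a, b}. q \<in> open_segment (polygon_vertex n i) (polygon_vertex n k)"
proof -
  let ?P = "polygon_vertex n" and ?L = "\<lambda>z. chord_normal n i k \<bullet> z" and ?c = "chord_level n i k"
  have a: "?c < ?L (?P a)" using assms by (intro chord_side(1)) auto
  have b: "?L (?P b) < ?c" using assms by (intro chord_side(2)) auto
  define t where "t = (?L (?P a) - ?c) / (?L (?P a) - ?L (?P b))"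
  have t: "0 \<le> t" "t \<le> 1" using a b by (auto simp: t_def field_simps)
  define q where "q = (1 - t) *\<^sub>R ?P a + t *\<^sub>R ?P b"
  have "q \<in> closed_segment (?P a) (?P b)"
    using t by (auto simp: q_def closed_segment_def)
  then have q: "q \<in> polygon_hull n {a, b}"
    by (simp add: polygon_hull_def segment_convex_hull)
  have "t * (?L (?P a) - ?L (?P b)) = ?L (?P a) - ?c" using a b by (simp add: t_def)
  then have "?L q = ?c" by (simp add: q_def inner_simps algebra_simps)
  then have "q \<in> closed_segment (?P i) (?P k)"
    using assms norm_polygon_hull_le[OF q] by (intro chord_closed_segment) auto
  moreover have "q \<noteq> ?P i" "q \<noteq> ?P k"
    using q polygon_vertex_in_hull_iff[of "{a, b}" n i] polygon_vertex_in_hull_iff[of "{a, b}" n k] assms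
    by auto
  ultimately show ?thesis using q by (auto simp: open_segment_def)
qed

section \<open>Shared edges and neighbours in a triangulation\<close>

lemma triangulation_triangle:
  assumes "is_triangulation n T" "t \<in> T"
  shows "t \<subseteq> {0..n}" "card t = 3" "finite t"
  using assms by (auto simp: is_triangulation_def intro: card_ge_0_finite)

text \<open>The intersection of the two triangles is a face of \<open>t\<close>, and a face that
  meets the interior of a segment of \<open>t\<close> contains its endpoints. A polygon vertex in
  the hull of \<open>s\<close> belongs to \<open>s\<close>.\<close>

lemma triangulation_shared_edge:
  assumes T: "is_triangulation n T" "s \<in> T" "t \<in> T" "s \<noteq> t"
    and ik: "i \<in> t" "k \<in> t"
    and q: "q \<in> polygon_hull n s" "q \<in> polygon_hull n t"
      "q \<in> open_segment (polygon_vertex n i) (polygon_vertex n k)"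
  shows "i \<in> s \<and> k \<in> s"
proof -
  have "polygon_hull n s \<inter> polygon_hull n t face_of polygon_hull n t"
    using T q unfolding is_triangulation_def by blast
  moreover have "polygon_vertex n i \<in> polygon_hull n t" "polygon_vertex n k \<in> polygon_hull n t"
    using ik by (auto simp: polygon_hull_def intro: hull_inc)
  ultimately have "polygon_vertex n i \<in> polygon_hull n s" "polygon_vertex n k \<in> polygon_hull n s"
    using q unfolding face_of_def by blast+
  moreover have "i \<le> n" "k \<le> n" using triangulation_triangle(1)[OF T(1,3)] ik by auto
  ultimately show ?thesis
    using polygon_vertex_in_hull_iff[OF triangulation_triangle(1)[OF T(1,2)]] by simp
qed

text \<open>If the chords crossed, \<open>i\<close> and \<open>k\<close> would be vertices of
  \<open>s\<close> besides \<open>a\<close> and \<open>b\<close>, giving a triangle with four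
  vertices.\<close>

lemma triangulation_noncrossing:
  assumes T: "is_triangulation n T" "s \<in> T" "t \<in> T"
    and ik: "i \<in> t" "k \<in> t" and ab: "a \<in> s" "b \<in> s"
    and c: "i < a" "a < k" "b < i \<or> k < b"
  shows False
proof -
  note s = triangulation_triangle[OF T(1,2)] and t = triangulation_triangle[OF T(1,3)]
  have four: "card {i, a, k, b} = 4" using c by auto
  have "i \<in> s \<and> k \<in> s"
  proof (cases "s = t")
    case False
    obtain q where q: "q \<in> polygon_hull n {a, b}"
        "q \<in> open_segment (polygon_vertex n i) (polygon_vertex n k)"
      using chords_cross[of i a k n b] c(1,2,3) subsetD[OF s(1) ab(2)] subsetD[OF t(1) ik(2)] by auto
    have "polygon_hull n {a, b} \<subseteq> polygon_hull n s" "polygon_hull n {i, k} \<subseteq> polygon_hull n t"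
      unfolding polygon_hull_def using ab ik by (auto intro!: hull_mono)
    moreover have "q \<in> polygon_hull n {i, k}"
      using q(2) by (simp add: polygon_hull_def segment_convex_hull[symmetric] open_segment_def)
    ultimately show ?thesis
      using triangulation_shared_edge[OF T False ik _ _ q(2)] q(1) by blast
  qed (use ik in simp)
  then have "card {i, a, k, b} \<le> card s" using ab s(3) by (intro card_mono) auto
  then show False using s(2) four by simp
qed

text \<open>The vertex \<open>0\<close> lies across the chord from \<open>j\<close>, so the polygon
  continues beyond the midpoint \<open>m\<close>. A triangle covering points just beyond
  \<open>m\<close> contains \<open>m\<close>, so it has \<open>i\<close> and \<open>k\<close> as
  vertices, and its third vertex is on the far side.\<close>

lemma triangulation_neighbour:
  assumes T: "is_triangulation n T" "{i, j, k} \<in> T" and c: "0 < i" "i < j" "j < k"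
  shows "\<exists>d. {i, k, d} \<in> T \<and> (d < i \<or> k < d)"
proof -
  let ?P = "polygon_vertex n" and ?L = "\<lambda>z. chord_normal n i k \<bullet> z" and ?c = "chord_level n i k"
  note t = triangulation_triangle[OF T]
  have k: "k \<le> n" using t(1) by simp
  define m where "m = midpoint (?P i) (?P k)"
  have side: "?L (?P i) = ?c" "?L (?P k) = ?c" "?L (?P j) > ?c" "?L (?P 0) < ?c"
    using c k by (auto intro!: chord_side)
  have "?P i \<noteq> ?P k"
    using polygon_vertex_in_hull_iff[of "{k}" n i] c k by (auto simp: polygon_hull_def)
  then have m: "m \<in> open_segment (?P i) (?P k)" by (simp add: m_def)
  have Lm: "?L m = ?c" using side by (simp add: m_def midpoint_def inner_simps)
  have "m \<in> polygon_hull n {i, k}"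
    using m by (simp add: polygon_hull_def segment_convex_hull[symmetric] open_segment_def)
  moreover have "polygon_hull n {i, k} \<subseteq> polygon_hull n {i, j, k}"
      "polygon_hull n {i, k} \<subseteq> polygon_hull n {0..n}"
    unfolding polygon_hull_def using c k by (auto intro!: hull_mono)
  ultimately have mt: "m \<in> polygon_hull n {i, j, k}" and mn: "m \<in> polygon_hull n {0..n}" by auto
  \<comment> \<open>A triangle covering points near \<open>m\<close> on the segment from \<open>m\<close> to the vertex \<open>0\<close> contains \<open>m\<close>.\<close>
  define U where "U = - (\<Union>s \<in> {s \<in> T. m \<notin> polygon_hull n s}. polygon_hull n s)"
  have "finite T"
    using T(1) unfolding is_triangulation_def by (intro finite_subset[of T "Pow {0..n}"]) auto
  moreover have "closed (polygon_hull n s)" if "s \<in> T" for s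
    unfolding polygon_hull_def using triangulation_triangle(3)[OF T(1) that]
    by (intro compact_imp_closed finite_imp_compact_convex_hull) auto
  ultimately have "open U" unfolding U_def by (intro open_Compl closed_UN) auto
  moreover have "m \<in> U" by (auto simp: U_def)
  ultimately obtain e where e: "e > 0" "ball m e \<subseteq> U" by (auto simp: open_contains_ball)
  \<comment> \<open>This scale brings \<open>z\<close> within \<open>e\<close> of \<open>m\<close>
    while keeping it on the segment to the vertex \<open>0\<close>; the \<open>+ 1\<close> keeps the
    denominator positive.\<close>
  define r where "r = min 1 (e / (2 * (norm (?P 0 - m) + 1)))"
  have r: "0 < r" "r \<le> 1" using e by (auto simp: r_def add_nonneg_pos)
  define z where "z = (1 - r) *\<^sub>R m + r *\<^sub>R ?P 0"
  have "r * norm (?P 0 - m) \<le> e / (2 * (norm (?P 0 - m) + 1)) * norm (?P 0 - m)"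
    by (intro mult_right_mono) (auto simp: r_def)
  also have "\<dots> < e"
    using e(1) by (simp add: field_simps add_pos_nonneg)
  finally have "dist m z < e"
    using r by (simp add: dist_norm z_def algebra_simps norm_minus_commute flip: scaleR_diff_right)
  then have "z \<in> U" using e(2) by auto
  have "?P 0 \<in> polygon_hull n {0..n}" by (simp add: polygon_vertex_in_hull_iff)
  then have "z \<in> polygon_hull n {0..n}"
    unfolding z_def using mn r unfolding polygon_hull_def by (intro convexD) auto
  then obtain s where s: "s \<in> T" "z \<in> polygon_hull n s"
  proof -
    have "(\<Union>t \<in> T. polygon_hull n t) = polygon_hull n {0..n}"
      using T(1) by (simp add: is_triangulation_def)
    then show ?thesis using \<open>z \<in> polygon_hull n {0..n}\<close> that by (metis UN_E)
  qed
  have ms: "m \<in> polygon_hull n s" using s \<open>z \<in> U\<close> by (auto simp: U_def)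
  have "r * ?L (?P 0) < r * ?c" using side(4) r by simp
  then have Lz: "?L z < ?c" using Lm by (simp add: z_def inner_simps algebra_simps)
  \<comment> \<open>If no vertex of \<open>s\<close> were strictly beyond the chord, the hull of
    \<open>s\<close>, and with it \<open>z\<close>, would stay on the side of
    \<open>j\<close>.\<close>
  then obtain d where d: "d \<in> s" "?L (?P d) < ?c"
    using polygon_hull_halfspace[of s ?c "chord_normal n i k" n z] s(2) by force
  have "d \<le> n" using triangulation_triangle(1)[OF T(1) s(1)] d(1) by auto
  have dd: "d < i \<or> k < d"
  proof (rule ccontr)
    assume "\<not> (d < i \<or> k < d)"
    then consider "i < d" "d < k" | "d = i \<or> d = k" by linarith
    then have "?c \<le> ?L (?P d)"
      using chord_side(1,3)[of i k n d] c k \<open>d \<le> n\<close> by cases auto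
    then show False using d(2) by simp
  qed
  then have "s \<noteq> {i, j, k}" using d(1) c by auto
  then have "i \<in> s \<and> k \<in> s"
    using triangulation_shared_edge[OF T(1) s(1) T(2) _ _ _ ms mt m] by auto
  moreover have "card {i, k, d} = 3" using dd c by auto
  ultimately have "{i, k, d} = s"
    using d(1) triangulation_triangle(2,3)[OF T(1) s(1)] by (intro card_subset_eq) auto
  then show ?thesis using s(1) dd by blast
qed

lemma triangulation_triangle_not_0:
  assumes T: "is_triangulation n T" and t: "\<exists>t \<in> T. 0 \<notin> t"
  obtains i j k where "0 < i" "i < j" "j < k" "k \<le> n" "{i, j, k} \<in> T" "{0, i, k} \<in> T"
proof -
  define Q where "Q = (\<lambda>(i, k). \<exists>j. 0 < i \<and> i < j \<and> j < k \<and> {i, j, k} \<in> T)"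
  obtain t where "t \<in> T" "0 \<notin> t" using t by blast
  have "card t = 3" by (rule triangulation_triangle(2)[OF T \<open>t \<in> T\<close>])
  then obtain x y z where xyz: "t = {x, y, z}" "x \<noteq> y" "y \<noteq> z" "x \<noteq> z" by (auto simp: card_3_iff)
  have "\<exists>i j k. t = {i, j, k} \<and> i < j \<and> j < k"
    using xyz by (metis insert_commute linorder_neqE_nat)
  then obtain i j k where "t = {i, j, k}" "i < j" "j < k" by blast
  then have "Q (i, k)" using \<open>t \<in> T\<close> \<open>0 \<notin> t\<close> by (auto simp: Q_def)
  moreover have le: "k \<le> n" if "Q (i, k)" for i k
    using that triangulation_triangle(1)[OF T] by (fastforce simp: Q_def)
  \<comment> \<open>The lengths \<open>k - i\<close> are bounded by \<open>n\<close>, so a greatest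
    one exists.\<close>
  ultimately obtain p where p: "Q p" "\<And>q. Q q \<Longrightarrow> snd q - fst q \<le> snd p - fst p"
    using ex_has_greatest_nat[of Q "(i, k)" "\<lambda>p. snd p - fst p" n] by fastforce
  obtain i k where "p = (i, k)" by (cases p)
  then obtain j where j: "0 < i" "i < j" "j < k" "{i, j, k} \<in> T" using p(1) by (auto simp: Q_def)
  obtain d where d: "{i, k, d} \<in> T" "d < i \<or> k < d"
    using triangulation_neighbour[OF T j(4,1,2,3)] by blast
  have "d = 0"
  proof (rule ccontr)
    assume "d \<noteq> 0"
    \<comment> \<open>With \<open>d\<close> nonzero the neighbour itself omits \<open>0\<close>, and
      its outer chord is longer than the maximal one.\<close>
    have "Q (d, k)" if "d < i"
      using that \<open>d \<noteq> 0\<close> d j by (auto simp: Q_def insert_commute intro!: exI[of _ i])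
    moreover have "Q (i, d)" if "k < d"
      using that d j by (auto simp: Q_def insert_commute intro!: exI[of _ k])
    ultimately show False using d(2) p(2) j \<open>p = (i, k)\<close> by fastforce
  qed
  then show ?thesis
    using that[of i j k] j d(1) le p(1) \<open>p = (i, k)\<close> by (simp add: insert_commute)
qed

section \<open>Pushouts and triangles in categories with cofibrations\<close>

lemma (in category) Hom_Ob: "f \<in> Hom C A B \<Longrightarrow> A \<in> Ob C \<and> B \<in> Ob C"
  using dom_in cod_in by (auto simp: Hom_def)

text \<open>Transfers what is shown for one explicit pushout, such as that a cobase change is a
  cofibration or the size of a quotient, to every pushout of the same span.\<close>

lemma (in category) pushout_unique:
  assumes P: "is_pushout C f g p q" and P': "is_pushout C f g p' q'"
  obtains h where "h \<in> Hom C (Cod C p) (Cod C p')" "is_iso C h" "Comp C h p = p'" "Comp C h q = q'"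
proof -
  have m: "p \<in> Hom C (Cod C f) (Cod C p)" "q \<in> Hom C (Cod C g) (Cod C p)" "Comp C p f = Comp C q g"
    "p' \<in> Hom C (Cod C f) (Cod C p')" "q' \<in> Hom C (Cod C g) (Cod C p')" "Comp C p' f = Comp C q' g"
    using P P' unfolding is_pushout_def Hom_def by auto
  have U: "\<exists>!h. h \<in> Hom C (Cod C p) E \<and> Comp C h p = u \<and> Comp C h q = v"
    if "u \<in> Hom C (Cod C f) E" "v \<in> Hom C (Cod C g) E" "Comp C u f = Comp C v g" for E u v
    using P that unfolding is_pushout_def by blast
  have U': "\<exists>!h. h \<in> Hom C (Cod C p') E \<and> Comp C h p' = u \<and> Comp C h q' = v"
    if "u \<in> Hom C (Cod C f) E" "v \<in> Hom C (Cod C g) E" "Comp C u f = Comp C v g" for E u v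
    using P' that unfolding is_pushout_def by blast
  obtain h where h: "h \<in> Hom C (Cod C p) (Cod C p')" "Comp C h p = p'" "Comp C h q = q'"
    using U[OF m(4-6)] by blast
  obtain k where k: "k \<in> Hom C (Cod C p') (Cod C p)" "Comp C k p' = p" "Comp C k q' = q"
    using U'[OF m(1-3)] by blast
  have "Cod C p \<in> Ob C" "Cod C p' \<in> Ob C" using Hom_Ob m(1,4) by blast+
  note i = id_in[OF this(1)] id_in[OF this(2)]
  have "Comp C (Comp C k h) p = p" "Comp C (Comp C k h) q = q"
    using comp_assoc[OF m(1) h(1) k(1)] comp_assoc[OF m(2) h(1) k(1)] h k by simp_all
  then have kh: "Comp C k h = Idm C (Cod C p)"
    using U[OF m(1-3)] comp_in[OF h(1) k(1)] i(1) comp_id_left[OF m(1)] comp_id_left[OF m(2)] by blast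
  have "Comp C (Comp C h k) p' = p'" "Comp C (Comp C h k) q' = q'"
    using comp_assoc[OF m(4) k(1) h(1)] comp_assoc[OF m(5) k(1) h(1)] h k by simp_all
  then have "Comp C h k = Idm C (Cod C p')"
    using U'[OF m(4-6)] comp_in[OF k(1) h(1)] i(2) comp_id_left[OF m(4)] comp_id_left[OF m(5)] by blast
  then have "is_iso C h" using kh h(1) k(1) by (auto simp: is_iso_def Hom_def)
  then show ?thesis using h that by blast
qed

context category_with_cofibrations
begin

definition zero_mor :: "'o \<Rightarrow> 'o \<Rightarrow> 'm" where
  "zero_mor A B = Comp C (THE f. f \<in> Hom C (Zero C) B) (THE f. f \<in> Hom C A (Zero C))"

lemma zero_mor_factors:
  assumes "f \<in> Hom C A (Zero C)" "g \<in> Hom C (Zero C) B"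
  shows "Comp C g f = zero_mor A B"
proof -
  have "(THE f. f \<in> Hom C A (Zero C)) = f" "(THE g. g \<in> Hom C (Zero C) B) = g"
    using assms hom_zero_eq by (blast intro: the_equality)+
  then show ?thesis by (simp add: zero_mor_def)
qed

lemma to_zero_ex: "A \<in> Ob C \<Longrightarrow> \<exists>f. f \<in> Hom C A (Zero C)"
  and from_zero_ex: "A \<in> Ob C \<Longrightarrow> \<exists>f. f \<in> Hom C (Zero C) A"
  using zero unfolding is_zero_object_def by blast+

lemma zero_mor_in:
  assumes "A \<in> Ob C" "B \<in> Ob C"
  shows "zero_mor A B \<in> Hom C A B"
  using to_zero_ex[OF assms(1)] from_zero_ex[OF assms(2)] comp_in zero_mor_factors by metis

lemma comp_zero_mor:
  assumes "f \<in> Hom C A B" "E \<in> Ob C"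
  shows "Comp C f (zero_mor E A) = zero_mor E B" "Comp C (zero_mor B E) f = zero_mor A E"
proof -
  have ob: "A \<in> Ob C" "B \<in> Ob C" using Hom_Ob[OF assms(1)] by auto
  obtain x y where xy: "x \<in> Hom C E (Zero C)" "y \<in> Hom C (Zero C) A"
    using to_zero_ex[OF assms(2)] from_zero_ex[OF ob(1)] by blast
  show "Comp C f (zero_mor E A) = zero_mor E B"
    using comp_assoc[OF xy assms(1)] zero_mor_factors[OF xy]
      zero_mor_factors[OF xy(1) comp_in[OF xy(2) assms(1)]] by simp
  obtain x y where xy: "x \<in> Hom C B (Zero C)" "y \<in> Hom C (Zero C) E"
    using to_zero_ex[OF ob(2)] from_zero_ex[OF assms(2)] by blast
  show "Comp C (zero_mor B E) f = zero_mor A E"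
    using comp_assoc[OF assms(1) xy] zero_mor_factors[OF xy]
      zero_mor_factors[OF comp_in[OF assms(1) xy(1)] xy(2)] by simp
qed

lemma cofibration_sequence_comp:
  assumes "is_cofibration_sequence C f p"
  shows "Comp C p f = zero_mor (Dom C f) (Cod C p)"
  using assms zero_mor_factors unfolding is_cofibration_sequence_def is_pushout_def by metis

text \<open>Object part of a cofibration sequence viewed as an object of
  \<open>S_ob C {0, 1, 2}\<close>; the default \<open>Zero C\<close> serves the diagonal
  positions.\<close>

definition triangle_ob :: "'m \<Rightarrow> 'm \<Rightarrow> nat \<times> nat \<Rightarrow> 'o" where
  "triangle_ob f p x = (if x = (0, 1) then Dom C f else if x = (0, 2) then Cod C f
     else if x = (1, 2) then Cod C p else Zero C)"

text \<open>Apart from identities and the relations carrying \<open>f\<close> and \<open>p\<close>,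
  a relation in \<open>Ar {0, 1, 2}\<close> has a diagonal endpoint, where the object is zero, or
  goes from \<open>(0, 1)\<close> to \<open>(1, 2)\<close>, where the value is \<open>p\<close>
  after \<open>f\<close>. Hence the zero morphism as default.\<close>

definition triangle_mor :: "'m \<Rightarrow> 'm \<Rightarrow> nat \<times> nat \<Rightarrow> nat \<times> nat \<Rightarrow> 'm" where
  "triangle_mor f p x y = (if x = y then Idm C (triangle_ob f p x)
     else if (x, y) = ((0, 1), (0, 2)) then f else if (x, y) = ((0, 2), (1, 2)) then p
     else zero_mor (triangle_ob f p x) (triangle_ob f p y))"

definition triangle :: "'m \<Rightarrow> 'm \<Rightarrow> ('o, 'm) diagram" where
  "triangle f p = (\<lambda>x \<in> Ar {0, 1, 2}. triangle_ob f p x,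
     \<lambda>xy \<in> Ar_rel {0, 1, 2}. triangle_mor f p (fst xy) (snd xy))"

lemma Ar_012: "Ar {0, 1, 2} = {(0, 0), (0, 1), (0, 2), (1, 1), (1, 2), (2, 2)}"
  by (auto simp: Ar_def)

text \<open>Functoriality holds because a composite of two nonidentity relations is sent to zero:
  either one factor is zero already, or the factors are \<open>f\<close> and
  \<open>p\<close>.\<close>

lemma triangle_in_S_ob:
  assumes s: "is_cofibration_sequence C f p"
  shows "triangle f p \<in> S_ob C {0, 1, 2}"
proof -
  let ?I = "{0, 1, 2} :: nat set" and ?o = "triangle_ob f p" and ?m = "triangle_mor f p"
  have m: "f \<in> Mor C" "p \<in> Mor C" "Dom C p = Cod C f"
    using s unfolding is_cofibration_sequence_def is_pushout_def by auto
  have ob: "?o x \<in> Ob C" for x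
    using m dom_in cod_in zero_in by (simp add: triangle_ob_def)
  have mor: "?m x y \<in> Hom C (?o x) (?o y)" for x y
  proof -
    consider "x = y" | "(x, y) = ((0, 1), (0, 2))" | "(x, y) = ((0, 2), (1, 2))"
      | "x \<noteq> y" "(x, y) \<noteq> ((0, 1), (0, 2))" "(x, y) \<noteq> ((0, 2), (1, 2))" by blast
    then show ?thesis
      by cases (use m id_in[OF ob] zero_mor_in[OF ob ob] in \<open>auto simp: triangle_mor_def triangle_ob_def Hom_def\<close>)
  qed
  have zero: "?m x y = zero_mor (?o x) (?o y)"
    if "x \<noteq> y \<and> (x, y) \<noteq> ((0, 1), (0, 2)) \<and> (x, y) \<noteq> ((0, 2), (1, 2))" for x y
    using that by (simp only: triangle_mor_def if_False simp_thms)
  have comp: "?m x z = Comp C (?m y z) (?m x y)" if r: "(x, y) \<in> Ar_rel ?I" "(y, z) \<in> Ar_rel ?I" for x y z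
  proof -
    \<comment> \<open>The relations carrying \<open>f\<close> and \<open>p\<close> are covering
      relations of the poset, so neither is a composite of two nonidentity relations.\<close>
    have z: "?m x z = zero_mor (?o x) (?o z)" if "x \<noteq> y" "y \<noteq> z"
    proof -
      have "x \<noteq> z \<and> (x, z) \<noteq> ((0, 1), (0, 2)) \<and> (x, z) \<noteq> ((0, 2), (1, 2))"
        using r that unfolding Ar_rel_def Ar_012 by (cases x; cases y; cases z) auto
      then show ?thesis by (rule zero)
    qed
    have "(x, y) = ((0, 1), (0, 2)) \<and> (y, z) = ((0, 2), (1, 2))"
      if "(x, y) = ((0, 1), (0, 2)) \<or> (x, y) = ((0, 2), (1, 2))"
        "(y, z) = ((0, 1), (0, 2)) \<or> (y, z) = ((0, 2), (1, 2))"
      using that by auto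
    then consider "x = y" | "y = z"
      | "x \<noteq> y" "y \<noteq> z" "?m x y = zero_mor (?o x) (?o y) \<or> ?m y z = zero_mor (?o y) (?o z)"
      | "x = (0, 1)" "y = (0, 2)" "z = (1, 2)"
      using zero[of x y] zero[of y z] by blast
    then show ?thesis
    proof cases
      case 1 then show ?thesis using comp_id_right[OF mor[of x z]] by (simp add: triangle_mor_def)
    next
      case 2 then show ?thesis using comp_id_left[OF mor[of x z]] by (simp add: triangle_mor_def)
    next
      case 3 then show ?thesis
        using z comp_zero_mor(1)[OF mor[of y z] ob[of x]] comp_zero_mor(2)[OF mor[of x y] ob[of z]] by auto
    next
      case 4 then show ?thesis
        using cofibration_sequence_comp[OF s] z by (simp add: triangle_mor_def triangle_ob_def)
    qed
  qed
  have tr: "(x, z) \<in> Ar_rel ?I" if "(x, y) \<in> Ar_rel ?I" "(y, z) \<in> Ar_rel ?I" for x y z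
    using that by (auto simp: Ar_rel_def)
  have "is_functor C ?I (triangle f p)"
    unfolding is_functor_def
  proof (intro conjI ballI allI impI)
    show "fst (triangle f p) \<in> Ar ?I \<rightarrow>\<^sub>E Ob C" using ob by (simp add: triangle_def)
    show "snd (triangle f p) \<in> extensional (Ar_rel ?I)" by (simp add: triangle_def)
  next
    fix x assume "x \<in> Ar_rel ?I"
    then show "case x of (x, y) \<Rightarrow> snd (triangle f p) (x, y)
        \<in> Hom C (fst (triangle f p) x) (fst (triangle f p) y)"
      using mor by (cases x) (auto simp: triangle_def dest: Ar_relD)
  next
    fix x assume "x \<in> Ar ?I"
    then show "snd (triangle f p) (x, x) = Idm C (fst (triangle f p) x)"
      by (simp add: triangle_def triangle_mor_def Ar_rel_def)
  next
    fix x y z assume "(x, y) \<in> Ar_rel ?I" "(y, z) \<in> Ar_rel ?I"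
    then show "snd (triangle f p) (x, z) =
        Comp C (snd (triangle f p) (y, z)) (snd (triangle f p) (x, y))"
      using comp tr by (simp add: triangle_def)
  qed
  moreover have "fst (triangle f p) (j, j) = Zero C" if "j \<in> ?I" for j
    using that by (auto simp: triangle_def triangle_ob_def Ar_def)
  moreover have "is_cofibration_sequence C (snd (triangle f p) ((i, j), (i, k)))
      (snd (triangle f p) ((i, k), (j, k)))" if "i \<in> ?I" "j \<in> ?I" "k \<in> ?I" "i < j" "j < k" for i j k
  proof -
    have "i = 0" "j = 1" "k = 2" using that by auto
    moreover have "((0, 1), (0, 2)) \<in> Ar_rel ?I" "((0, 2), (1, 2)) \<in> Ar_rel ?I"
      by (auto simp: Ar_rel_def Ar_def)
    ultimately show ?thesis using s by (simp add: triangle_def triangle_mor_def)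
  qed
  ultimately show ?thesis unfolding S_ob_def mem_Collect_eq by (intro conjI ballI impI)
qed

section \<open>Components of isomorphisms and pullbacks of triangles\<close>

lemma S_cat_iso_components:
  assumes "(M, N) \<in> iso_rel (S_cat C I)"
  obtains \<eta> where "is_nat_trans C I M N \<eta>" "\<And>p. p \<in> Ar I \<Longrightarrow> is_iso C (\<eta> p)"
proof -
  obtain f g where f: "f \<in> Hom (S_cat C I) M N" and g: "g \<in> Hom (S_cat C I) N M"
    and gf: "Comp (S_cat C I) g f = Idm (S_cat C I) M" and fg: "Comp (S_cat C I) f g = Idm (S_cat C I) N"
    by (rule category.iso_relE[OF category_S_cat assms])
  obtain \<eta> where \<eta>: "f = (M, N, \<eta>)" "is_nat_trans C I M N \<eta>"
    using f by (auto simp: S_cat_def Hom_def)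
  obtain \<theta> where \<theta>: "g = (N, M, \<theta>)" "is_nat_trans C I N M \<theta>"
    using g by (auto simp: S_cat_def Hom_def)
  have "is_iso C (\<eta> p)" if "p \<in> Ar I" for p
  proof -
    have "Comp C (\<theta> p) (\<eta> p) = Idm C (fst M p)" "Comp C (\<eta> p) (\<theta> p) = Idm C (fst N p)"
      using gf fg that by (auto simp: \<eta> \<theta> S_cat_def dest!: fun_cong[where x = p])
    then show ?thesis
      using is_nat_transD(2)[OF \<eta>(2) that] is_nat_transD(2)[OF \<theta>(2) that]
      by (auto simp: is_iso_def Hom_def)
  qed
  then show ?thesis using \<eta>(2) that by blast
qed

text \<open>Pullbacks of one object along a single map are compatible under restriction; points of
  the limit are built this way.\<close>

lemma iso_s_act_pull:
  assumes A: "A \<in> S_ob C K" and \<psi>: "ordinal_map J K \<psi>" and I: "I \<subseteq> J" "I \<noteq> {}"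
  shows "Act (iso_s C) I J id (iso_rel (S_cat C J) `` {S_pull J \<psi> A})
    = iso_rel (S_cat C I) `` {S_pull I \<psi> A}"
proof -
  have m: "ordinal_map I J id"
    using I \<psi> by (auto simp: ordinal_map_def ordinal_def mono_on_def intro: finite_subset)
  show ?thesis
    using iso_s_act[OF m S_pull_in[OF \<psi> A]] S_pull_comp[OF m, of \<psi> A] by simp
qed

text \<open>On the edge \<open>{i, k}\<close> the first triangle shows its position
  \<open>(1, 2)\<close>, the quotient of \<open>f\<close>, and the second its position
  \<open>(0, 2)\<close>, the target of \<open>g\<close>. These objects coincide, so the pullbacks
  are equal and not merely isomorphic.\<close>

lemma S_pull_triangle_edge:
  assumes "Cod C g = Cod C p" "i < k" "\<phi> i = 1" "\<phi> k = 2" "\<psi> i = 0" "\<psi> k = 2"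
  shows "S_pull {i, k} \<phi> (triangle f p) = S_pull {i, k} \<psi> (triangle g q)"
proof -
  have Ar: "Ar {i, k} = {(i, i), (i, k), (k, k)}" using assms(2) by (auto simp: Ar_def)
  have ob: "triangle_ob f p (map_prod \<phi> \<phi> x) = triangle_ob g q (map_prod \<psi> \<psi> x)"
    if "x \<in> Ar {i, k}" for x
    using that assms unfolding Ar by (auto simp: triangle_ob_def)
  have mor: "triangle_mor f p (map_prod \<phi> \<phi> x) (map_prod \<phi> \<phi> y)
      = triangle_mor g q (map_prod \<psi> \<psi> x) (map_prod \<psi> \<psi> y)" if xy: "(x, y) \<in> Ar_rel {i, k}" for x y
  proof -
    have "x \<in> Ar {i, k}" "y \<in> Ar {i, k}" using Ar_relD[OF xy] by auto
    note o = ob[OF this(1)] ob[OF this(2)]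
    \<comment> \<open>Neither pullback meets a relation carrying \<open>f\<close>, \<open>p\<close>,
      \<open>g\<close> or \<open>q\<close>, so only the identity and zero branches of
      \<open>triangle_mor\<close> remain.\<close>
    have "(map_prod \<phi> \<phi> x = map_prod \<phi> \<phi> y \<longleftrightarrow> x = y) \<and> (map_prod \<psi> \<psi> x = map_prod \<psi> \<psi> y \<longleftrightarrow> x = y)
        \<and> map_prod \<phi> \<phi> x \<noteq> (0, 1) \<and> map_prod \<phi> \<phi> x \<noteq> (0, 2) \<and> map_prod \<psi> \<psi> x \<noteq> (0, 1) \<and> map_prod \<psi> \<psi> y \<noteq> (1, 2)"
      using \<open>x \<in> Ar {i, k}\<close> \<open>y \<in> Ar {i, k}\<close> assms unfolding Ar by auto
    then show ?thesis unfolding triangle_mor_def o by auto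
  qed
  have m: "ordinal_map {i, k} {0, 1, 2} \<phi>" "ordinal_map {i, k} {0, 1, 2} \<psi>"
    using assms by (auto simp: ordinal_map_def ordinal_def mono_on_def)
  have "fst (S_pull {i, k} \<phi> (triangle f p)) = fst (S_pull {i, k} \<psi> (triangle g q))"
    using ob ordinal_map_Ar(1)[OF m(1)] ordinal_map_Ar(1)[OF m(2)]
    by (auto simp: S_pull_def triangle_def intro!: restrict_ext)
  moreover have "snd (S_pull {i, k} \<phi> (triangle f p)) = snd (S_pull {i, k} \<psi> (triangle g q))"
    using mor ordinal_map_Ar(2)[OF m(1)] ordinal_map_Ar(2)[OF m(2)]
    by (auto simp: S_pull_def triangle_def intro!: restrict_ext)
  ultimately show ?thesis by (rule prod_eqI)
qed

end

section \<open>Finite pointed sets with a self-map\<close>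

text \<open>Finite sets of natural numbers with extensional self-maps form a countable set, so
  objects can be coded by numbers.\<close>

definition endo_sets :: "(nat set \<times> (nat \<Rightarrow> nat)) set" where
  "endo_sets = {(S, x). finite S \<and> 0 \<in> S \<and> x \<in> S \<rightarrow>\<^sub>E S \<and> x 0 = 0}"

definition car :: "nat \<Rightarrow> nat set" where "car a = fst (from_nat_into endo_sets a)"

definition act :: "nat \<Rightarrow> nat \<Rightarrow> nat" where "act a = snd (from_nat_into endo_sets a)"

definition endo_maps :: "nat \<Rightarrow> nat \<Rightarrow> (nat \<Rightarrow> nat) set" where
  "endo_maps a b = {f \<in> car a \<rightarrow>\<^sub>E car b. f 0 = 0 \<and> (\<forall>s \<in> car a. f (act a s) = act b (f s))}"

definition endo_code :: "nat \<times> nat \<times> (nat \<Rightarrow> nat) \<Rightarrow> nat" where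
  "endo_code = to_nat_on {(a, b, f). f \<in> endo_maps a b}"

definition endo_decode :: "nat \<Rightarrow> nat \<times> nat \<times> (nat \<Rightarrow> nat)" where
  "endo_decode = from_nat_into {(a, b, f). f \<in> endo_maps a b}"

definition endo_dom :: "nat \<Rightarrow> nat" where "endo_dom m = fst (endo_decode m)"
definition endo_cod :: "nat \<Rightarrow> nat" where "endo_cod m = fst (snd (endo_decode m))"
definition app :: "nat \<Rightarrow> nat \<Rightarrow> nat" where "app m = snd (snd (endo_decode m))"

text \<open>
  Every natural number codes an object, and different numbers may code the same pointed set with
  self-map. Morphisms are coded injectively, together with the codes of their source and target.
\<close>

definition endo_cat :: "(nat, nat) cofcat" where
  "endo_cat = \<lparr>
     Ob = UNIV,
     Mor = endo_code ` {(a, b, f). f \<in> endo_maps a b},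
     Dom = endo_dom,
     Cod = endo_cod,
     Idm = (\<lambda>a. endo_code (a, a, \<lambda>s \<in> car a. s)),
     Comp = (\<lambda>g f. endo_code (endo_dom f, endo_cod g, compose (car (endo_dom f)) (app g) (app f))),
     Zero = (SOME a. car a = {0}),
     Cof = {f \<in> endo_code ` {(a, b, f). f \<in> endo_maps a b}.
       inj_on (app f) (car (endo_dom f)) \<and>
       (\<forall>s \<in> car (endo_dom f) - {0}.
          even (card {y \<in> car (endo_cod f) - app f ` car (endo_dom f). act (endo_cod f) y = app f s}))}\<rparr>"

lemma countable_endo_sets: "countable endo_sets"
proof -
  have "endo_sets \<subseteq> (SIGMA S:{S. finite S}. S \<rightarrow>\<^sub>E S)" by (auto simp: endo_sets_def)
  moreover have "countable (SIGMA S:{S :: nat set. finite S}. S \<rightarrow>\<^sub>E S)"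
    by (intro countable_SIGMA countable_Collect_finite countable_PiE) auto
  ultimately show ?thesis by (rule countable_subset)
qed

lemma endo_sets_nonempty: "endo_sets \<noteq> {}"
proof -
  have "({0}, \<lambda>s \<in> {0}. 0) \<in> endo_sets" by (simp add: endo_sets_def)
  then show ?thesis by blast
qed

lemma car_act:
  shows finite_car: "finite (car a)" and zero_in_car: "0 \<in> car a"
    and act_in_car: "s \<in> car a \<Longrightarrow> act a s \<in> car a" and act_0: "act a 0 = 0"
  using from_nat_into[OF endo_sets_nonempty, of a] unfolding car_def act_def endo_sets_def by auto

lemma endo_ob_ex:
  assumes "finite S" "0 \<in> S" "\<And>s. s \<in> S \<Longrightarrow> x s \<in> S" "x 0 = 0"
  shows "\<exists>a. car a = S \<and> (\<forall>s \<in> S. act a s = x s)"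
proof -
  have "(S, restrict x S) \<in> endo_sets" using assms by (auto simp: endo_sets_def)
  then obtain a where "from_nat_into endo_sets a = (S, restrict x S)"
    using from_nat_into_surj[OF countable_endo_sets] by blast
  then show ?thesis by (intro exI[of _ a]) (simp add: car_def act_def)
qed

lemma countable_endo_maps: "countable {(a, b, f). f \<in> endo_maps a b}"
proof -
  have "{(a, b, f). f \<in> endo_maps a b} \<subseteq> (SIGMA a:UNIV. SIGMA b:UNIV. car a \<rightarrow>\<^sub>E car b)"
    by (auto simp: endo_maps_def)
  moreover have "countable (SIGMA a:UNIV. SIGMA b:UNIV. car a \<rightarrow>\<^sub>E car b)"
    by (intro countable_SIGMA countable_PiE finite_car) (auto simp: countable_finite finite_car)
  ultimately show ?thesis by (rule countable_subset)
qed

lemma endo_decode_code: "f \<in> endo_maps a b \<Longrightarrow> endo_decode (endo_code (a, b, f)) = (a, b, f)"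
  unfolding endo_decode_def endo_code_def
  by (rule from_nat_into_to_nat_on[OF countable_endo_maps]) simp

section \<open>Morphisms and composition in the coded category\<close>

lemma Hom_endo_cat: "Hom endo_cat a b = (\<lambda>f. endo_code (a, b, f)) ` endo_maps a b"
  unfolding Hom_def endo_cat_def endo_dom_def endo_cod_def
  by (auto simp: endo_decode_code)

lemma app_endo_code: "f \<in> endo_maps a b \<Longrightarrow> app (endo_code (a, b, f)) = f"
  by (simp add: app_def endo_decode_code)

lemma app_in_endo_maps: "m \<in> Hom endo_cat a b \<Longrightarrow> app m \<in> endo_maps a b"
  by (auto simp: Hom_endo_cat app_endo_code)

lemma endo_homD:
  assumes "m \<in> Hom endo_cat a b"
  shows "s \<in> car a \<Longrightarrow> app m s \<in> car b" "app m 0 = 0"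
    "s \<in> car a \<Longrightarrow> app m (act a s) = act b (app m s)"
  using app_in_endo_maps[OF assms] by (auto simp: endo_maps_def)

lemma endo_dom_cod: "m \<in> Hom endo_cat a b \<Longrightarrow> endo_dom m = a \<and> endo_cod m = b"
  by (auto simp: Hom_def endo_cat_def)

lemma endo_hom_eqI:
  assumes "m \<in> Hom endo_cat a b" "m' \<in> Hom endo_cat a b" "\<And>s. s \<in> car a \<Longrightarrow> app m s = app m' s"
  shows "m = m'"
proof -
  have "app m = app m'"
    using assms(3) app_in_endo_maps[OF assms(1)] app_in_endo_maps[OF assms(2)]
    unfolding endo_maps_def by (auto intro: PiE_ext)
  then show ?thesis using assms(1,2) by (auto simp: Hom_endo_cat app_endo_code)
qed

lemma endo_hom_ex:
  assumes "\<And>s. s \<in> car a \<Longrightarrow> f s \<in> car b" "f 0 = 0"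
    "\<And>s. s \<in> car a \<Longrightarrow> f (act a s) = act b (f s)"
  shows "\<exists>m \<in> Hom endo_cat a b. \<forall>s \<in> car a. app m s = f s"
proof -
  have "restrict f (car a) \<in> endo_maps a b"
    using assms by (auto simp: endo_maps_def zero_in_car act_in_car)
  then show ?thesis
    by (intro bexI[of _ "endo_code (a, b, restrict f (car a))"]) (simp_all add: Hom_endo_cat app_endo_code)
qed

lemma endo_id:
  shows "Idm endo_cat a \<in> Hom endo_cat a a" "s \<in> car a \<Longrightarrow> app (Idm endo_cat a) s = s"
proof -
  have "(\<lambda>s \<in> car a. s) \<in> endo_maps a a"
    by (auto simp: endo_maps_def zero_in_car act_in_car)
  then show "Idm endo_cat a \<in> Hom endo_cat a a" "s \<in> car a \<Longrightarrow> app (Idm endo_cat a) s = s"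
    by (auto simp: endo_cat_def[THEN arg_cong[where f = Idm]] Hom_endo_cat app_endo_code)
qed

lemma endo_comp:
  assumes f: "f \<in> Hom endo_cat a b" and g: "g \<in> Hom endo_cat b c"
  shows "Comp endo_cat g f \<in> Hom endo_cat a c"
    "s \<in> car a \<Longrightarrow> app (Comp endo_cat g f) s = app g (app f s)"
proof -
  have m: "compose (car a) (app g) (app f) \<in> endo_maps a c"
    using endo_homD[OF f] endo_homD[OF g]
    by (auto simp: endo_maps_def zero_in_car act_in_car compose_def)
  have "Comp endo_cat g f = endo_code (a, c, compose (car a) (app g) (app f))"
    using endo_dom_cod[OF f] endo_dom_cod[OF g] by (simp add: endo_cat_def)
  then show "Comp endo_cat g f \<in> Hom endo_cat a c"
    "s \<in> car a \<Longrightarrow> app (Comp endo_cat g f) s = app g (app f s)"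
    using m by (simp_all add: Hom_endo_cat app_endo_code compose_eq)
qed

lemma Dom_Cod_endo_cat: "m \<in> Hom endo_cat a b \<Longrightarrow> m \<in> Mor endo_cat \<and> Dom endo_cat m = a \<and> Cod endo_cat m = b"
  by (simp add: Hom_def)

interpretation endo: category endo_cat
proof
  fix f g h A B D E
  assume "f \<in> Hom endo_cat A B" "g \<in> Hom endo_cat B D" "h \<in> Hom endo_cat D E"
  note fgh = this and gf = endo_comp(1)[OF this(1,2)] and hg = endo_comp(1)[OF this(2,3)]
  show "Comp endo_cat h (Comp endo_cat g f) = Comp endo_cat (Comp endo_cat h g) f"
    by (rule endo_hom_eqI[OF endo_comp(1)[OF gf fgh(3)] endo_comp(1)[OF fgh(1) hg]])
      (simp add: endo_comp(2)[OF gf fgh(3)] endo_comp(2)[OF fgh(1) hg] endo_comp(2)[OF fgh(1,2)]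
        endo_comp(2)[OF fgh(2,3)] endo_homD[OF fgh(1)])
next
  fix f A B assume f: "f \<in> Hom endo_cat A B"
  show "Comp endo_cat f (Idm endo_cat A) = f"
    by (rule endo_hom_eqI[OF endo_comp(1)[OF endo_id(1) f] f])
      (simp add: endo_comp(2)[OF endo_id(1) f] endo_id)
  show "Comp endo_cat (Idm endo_cat B) f = f"
    by (rule endo_hom_eqI[OF endo_comp(1)[OF f endo_id(1)] f])
      (simp add: endo_comp(2)[OF f endo_id(1)] endo_id endo_homD[OF f])
qed (simp_all add: endo_id endo_comp endo_cat_def[THEN arg_cong[where f = Ob]])

section \<open>Isomorphisms and composites as cofibrations\<close>

lemma Cof_endo_cat:
  assumes "f \<in> Hom endo_cat a b"
  shows "f \<in> Cof endo_cat \<longleftrightarrow> inj_on (app f) (car a) \<and>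
    (\<forall>s \<in> car a - {0}. even (card {y \<in> car b - app f ` car a. act b y = app f s}))"
proof -
  have "f \<in> endo_code ` {(a, b, f). f \<in> endo_maps a b}"
    using assms by (auto simp: Hom_endo_cat)
  then show ?thesis using endo_dom_cod[OF assms] by (simp add: endo_cat_def)
qed

lemma is_iso_endo_bij:
  assumes "is_iso endo_cat f" "f \<in> Hom endo_cat a b"
  shows "bij_betw (app f) (car a) (car b)"
proof -
  obtain g where g: "g \<in> Hom endo_cat b a" "Comp endo_cat g f = Idm endo_cat a"
      "Comp endo_cat f g = Idm endo_cat b"
    using assms by (auto simp: is_iso_def Hom_def)
  have 1: "app g (app f s) = s" if "s \<in> car a" for s
    using endo_comp(2)[OF assms(2) g(1) that] endo_id(2)[OF that] g(2) by simp
  have 2: "app f (app g s) = s" if "s \<in> car b" for s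
    using endo_comp(2)[OF g(1) assms(2) that] endo_id(2)[OF that] g(3) by simp
  show ?thesis
    using 1 2 endo_homD(1)[OF assms(2)] endo_homD(1)[OF g(1)]
    by (intro bij_betwI[where g = "app g"]) auto
qed

lemma endo_cof_iso:
  assumes "is_iso endo_cat f"
  shows "f \<in> Cof endo_cat"
proof -
  have f: "f \<in> Hom endo_cat (Dom endo_cat f) (Cod endo_cat f)"
    using assms by (simp add: is_iso_def Hom_def)
  show ?thesis
    using is_iso_endo_bij[OF assms f] by (simp add: Cof_endo_cat[OF f] bij_betw_def)
qed

text \<open>Preimages of \<open>g (f s)\<close> outside the image of the composite split into those
  outside the image of \<open>g\<close> and the images under \<open>g\<close> of the preimages of
  \<open>f s\<close> outside the image of \<open>f\<close>. Both counts are even.\<close>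

lemma endo_cof_comp:
  assumes f: "f \<in> Cof endo_cat" "f \<in> Hom endo_cat a b" and g: "g \<in> Cof endo_cat" "g \<in> Hom endo_cat b c"
  shows "Comp endo_cat g f \<in> Cof endo_cat"
proof -
  note f' = f(1)[unfolded Cof_endo_cat[OF f(2)]] and g' = g(1)[unfolded Cof_endo_cat[OF g(2)]]
  note fh = endo_homD[OF f(2)] and gh = endo_homD[OF g(2)]
  let ?h = "app (Comp endo_cat g f)"
  have h: "?h s = app g (app f s)" if "s \<in> car a" for s
    by (rule endo_comp(2)[OF f(2) g(2) that])
  have im: "?h ` car a = app g ` app f ` car a" using h by (auto simp: image_image)
  have "inj_on ?h (car a)"
    using f' g' fh(1) h by (auto simp: inj_on_def)
  moreover have "even (card {y \<in> car c - ?h ` car a. act c y = ?h s})" if s: "s \<in> car a - {0}" for s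
  proof -
    let ?F = "{y \<in> car b - app f ` car a. act b y = app f s}"
    let ?G = "{y \<in> car c - app g ` car b. act c y = app g (app f s)}"
    have inj: "inj_on (app g) (car b)" using g' by blast
    have eq: "app g x = app g y \<longleftrightarrow> x = y" if "x \<in> car b" "y \<in> car b" for x y
      using inj_on_eq_iff[OF inj that] .
    have "{y \<in> car c - ?h ` car a. act c y = ?h s} = app g ` ?F \<union> ?G"
    proof (rule set_eqI)
      fix y
      show "y \<in> {y \<in> car c - ?h ` car a. act c y = ?h s} \<longleftrightarrow> y \<in> app g ` ?F \<union> ?G"
      proof (cases "y \<in> app g ` car b")
        case True
        then obtain x where x: "x \<in> car b" "y = app g x" by blast
        have "act c y = ?h s \<longleftrightarrow> act b x = app f s"
          using x s h gh(3) eq[of "act b x" "app f s"] fh(1) by (auto simp: act_in_car simp flip: gh(3))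
        moreover have "y \<in> app g ` app f ` car a \<longleftrightarrow> x \<in> app f ` car a"
          using x fh(1) inj by (auto dest: inj_onD)
        moreover have "y \<in> app g ` ?F \<longleftrightarrow> x \<in> ?F"
          using x inj by (auto dest: inj_onD)
        ultimately show ?thesis using True x gh(1) unfolding im by auto
      next
        case False
        then show ?thesis using s h fh(1) unfolding im by auto
      qed
    qed
    moreover have "card (app g ` ?F \<union> ?G) = card (app g ` ?F) + card ?G"
      by (intro card_Un_disjoint) (auto intro: finite_subset[OF _ finite_car])
    moreover have "card (app g ` ?F) = card ?F"
      by (intro card_image inj_on_subset[OF inj]) auto
    \<comment> \<open>The parity condition on \<open>g\<close> concerns nonzero elements, and
      \<open>f s\<close> is nonzero by injectivity.\<close>
    moreover have "app f s \<in> car b - {0}"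
      using s fh f' zero_in_car[of a] by (auto dest!: inj_onD[of _ _ s 0])
    then have "even (card ?G)" using g' by blast
    moreover have "even (card ?F)" using f' s by blast
    ultimately show ?thesis by simp
  qed
  ultimately show ?thesis by (simp add: Cof_endo_cat[OF endo_comp(1)[OF f(2) g(2)]])
qed

section \<open>Pushouts along cofibrations as gluings\<close>

lemma is_pushout_endoI:
  assumes f: "f \<in> Hom endo_cat a b" and g: "g \<in> Hom endo_cat a c"
    and p: "p \<in> Hom endo_cat b d" and q: "q \<in> Hom endo_cat c d"
    and com: "\<And>s. s \<in> car a \<Longrightarrow> app p (app f s) = app q (app g s)"
    and qi: "inj_on (app q) (car c)"
    and pb: "bij_betw (app p) (car b - app f ` car a) (car d - app q ` car c)"
  shows "is_pushout endo_cat f g p q"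
proof -
  note D = Dom_Cod_endo_cat[OF f] Dom_Cod_endo_cat[OF g] Dom_Cod_endo_cat[OF p] Dom_Cod_endo_cat[OF q]
  note H = endo_homD[OF f] endo_homD[OF g]
  have cov: "(\<exists>s \<in> car b. y = app p s) \<or> (\<exists>t \<in> car c. y = app q t)" if "y \<in> car d" for y
    using that pb unfolding bij_betw_def by blast
  have "Comp endo_cat p f = Comp endo_cat q g"
    by (rule endo_hom_eqI[OF endo_comp(1)[OF f p] endo_comp(1)[OF g q]])
      (simp add: endo_comp(2)[OF f p] endo_comp(2)[OF g q] com)
  moreover have "\<exists>!h. h \<in> Hom endo_cat d e \<and> Comp endo_cat h p = u \<and> Comp endo_cat h q = v"
    if u: "u \<in> Hom endo_cat b e" and v: "v \<in> Hom endo_cat c e"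
      and uv: "Comp endo_cat u f = Comp endo_cat v g" for e u v
  proof -
    note p' = endo_homD[OF p] and q' = endo_homD[OF q] and u' = endo_homD[OF u] and v' = endo_homD[OF v]
    have uv': "app u (app f s) = app v (app g s)" if "s \<in> car a" for s
      using arg_cong[OF uv, of "\<lambda>m. app m s"] endo_comp(2)[OF f u that] endo_comp(2)[OF g v that] by simp
    \<comment> \<open>By the hypotheses on \<open>p\<close> and \<open>q\<close>, \<open>d\<close>
      is the disjoint union of a copy of \<open>c\<close> and a copy of the complement of
      \<open>f\<close> in \<open>b\<close>; the induced map is \<open>v\<close> on the first and
      \<open>u\<close> on the second.\<close>
    define h where "h y = (if y \<in> app q ` car c then app v (inv_into (car c) (app q) y)
      else app u (inv_into (car b - app f ` car a) (app p) y))" for y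
    have hq: "h (app q t) = app v t" if "t \<in> car c" for t
      using that qi by (simp add: h_def)
    have hp: "h (app p s) = app u s" if s: "s \<in> car b" for s
    proof (cases "s \<in> app f ` car a")
      case True
      then show ?thesis using com uv' hq H by auto
    next
      case False
      then have "app p s \<notin> app q ` car c" using pb s unfolding bij_betw_def by blast
      moreover have "inv_into (car b - app f ` car a) (app p) (app p s) = s"
        using False s pb by (intro inv_into_f_f) (auto simp: bij_betw_def)
      ultimately show ?thesis by (simp add: h_def)
    qed
    have h1: "h y \<in> car e \<and> h (act d y) = act e (h y)" if "y \<in> car d" for y
      using cov[OF that] hp hq u' v' by (auto simp: act_in_car simp flip: p'(3) q'(3))
    have h0: "h 0 = 0" using hq[OF zero_in_car] q'(2) v'(2) by simp
    obtain m where m: "m \<in> Hom endo_cat d e" "\<And>y. y \<in> car d \<Longrightarrow> app m y = h y"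
      using endo_hom_ex[of d h e] h1 h0 by blast
    have "Comp endo_cat m p = u"
      by (rule endo_hom_eqI[OF endo_comp(1)[OF p m(1)] u])
        (simp add: endo_comp(2)[OF p m(1)] m(2) p'(1) hp)
    moreover have "Comp endo_cat m q = v"
      by (rule endo_hom_eqI[OF endo_comp(1)[OF q m(1)] v])
        (simp add: endo_comp(2)[OF q m(1)] m(2) q'(1) hq)
    moreover have "k = m" if k: "k \<in> Hom endo_cat d e" "Comp endo_cat k p = u" "Comp endo_cat k q = v" for k
    proof (rule endo_hom_eqI[OF k(1) m(1)])
      fix y assume y: "y \<in> car d"
      have "app k (app p s) = app u s" if "s \<in> car b" for s
        using endo_comp(2)[OF p k(1) that] k(2) by simp
      moreover have "app k (app q t) = app v t" if "t \<in> car c" for t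
        using endo_comp(2)[OF q k(1) that] k(3) by simp
      ultimately show "app k y = app m y"
        using cov[OF y] m(2)[OF y] hp hq by auto
    qed
    ultimately show ?thesis using m(1) by blast
  qed
  ultimately show ?thesis
    unfolding is_pushout_def using D by simp
qed

text \<open>Preimages of \<open>q t\<close> outside the copy of \<open>c\<close> are the preimages,
  outside the image of \<open>f\<close>, of all \<open>f r\<close> with \<open>g r = t\<close>.
  Their number is a sum of even numbers, so \<open>q\<close> is a cofibration. The cardinality is
  recorded for counting in cofibration sequences.\<close>

lemma endo_pushout_ex:
  assumes f: "f \<in> Cof endo_cat" "f \<in> Hom endo_cat a b" and g: "g \<in> Hom endo_cat a c"
  obtains d p q where "p \<in> Hom endo_cat b d" "q \<in> Hom endo_cat c d" "is_pushout endo_cat f g p q"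
    "q \<in> Cof endo_cat" "card (car d) = card (car c) + card (car b - app f ` car a)"
proof -
  note fh = endo_homD[OF f(2)] and gh = endo_homD[OF g]
  note f' = f(1)[unfolded Cof_endo_cat[OF f(2)]]
  have inj: "inj_on (app f) (car a)" using f' by blast
  let ?N = "car b - app f ` car a"
  \<comment> \<open>The even numbers carry a copy of \<open>c\<close>, the odd ones the elements of \<open>b\<close> outside the image of \<open>f\<close>.\<close>
  define S where "S = (\<lambda>t. 2 * t) ` car c \<union> (\<lambda>s. 2 * s + 1) ` ?N"
  define pp where "pp s = (if s \<in> app f ` car a then 2 * app g (inv_into (car a) (app f) s) else 2 * s + 1)" for s
  \<comment> \<open>The self-map may lead from the odd part into the copy of \<open>c\<close>: a
    value in the image of \<open>f\<close> is replaced through \<open>pp\<close> by the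
    corresponding value of \<open>g\<close>.\<close>
  define x where "x y = (if even y then 2 * act c (y div 2) else pp (act b (y div 2)))" for y
  have ppf: "pp (app f s) = 2 * app g s" if "s \<in> car a" for s
    using that inj by (simp add: pp_def)
  have ppn: "pp s = 2 * s + 1" if "s \<in> ?N" for s using that by (simp add: pp_def)
  have ppS: "pp s \<in> S" if s: "s \<in> car b" for s
  proof (cases "s \<in> app f ` car a")
    case True then show ?thesis using ppf gh(1) by (auto simp: S_def)
  next
    case False then show ?thesis using ppn s by (simp add: S_def)
  qed
  have "\<exists>d. car d = S \<and> (\<forall>y \<in> S. act d y = x y)"
  proof (rule endo_ob_ex)
    show "finite S" by (simp add: S_def finite_car)
    show "0 \<in> S" using zero_in_car[of c] by (auto simp: S_def)
    show "x 0 = 0" by (simp add: x_def act_0)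
    show "x y \<in> S" if y: "y \<in> S" for y
    proof -
      consider t where "t \<in> car c" "y = 2 * t" | s where "s \<in> car b" "y = 2 * s + 1"
        using y by (auto simp: S_def)
      then show ?thesis
      proof cases
        case 1 then show ?thesis by (simp add: x_def S_def act_in_car)
      next
        case 2 then show ?thesis using ppS[OF act_in_car] by (simp add: x_def)
      qed
    qed
  qed
  then obtain d where d: "car d = S" "\<And>y. y \<in> S \<Longrightarrow> act d y = x y" by blast
  have dq: "act d (2 * t) = 2 * act c t" if "t \<in> car c" for t
    using that d(2)[of "2 * t"] by (simp add: S_def x_def)
  have dp: "act d (pp s) = pp (act b s)" if s: "s \<in> car b" for s
  proof (cases "s \<in> app f ` car a")
    case True
    then show ?thesis using ppf dq gh(1,3) by (auto simp: act_in_car simp flip: fh(3))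
  next
    case False
    then show ?thesis using s ppn[of s] d(2)[OF ppS[OF s]] by (simp add: x_def)
  qed
  have "pp 0 = 0" using ppf[OF zero_in_car] fh(2) gh(2) by simp
  then obtain p where p: "p \<in> Hom endo_cat b d" "\<And>s. s \<in> car b \<Longrightarrow> app p s = pp s"
    using endo_hom_ex[of b pp d] ppS dp d(1) by metis
  obtain q where q: "q \<in> Hom endo_cat c d" "\<And>t. t \<in> car c \<Longrightarrow> app q t = 2 * t"
    using endo_hom_ex[of c "\<lambda>t. 2 * t" d] d(1) dq by (auto simp: S_def)
  have qim: "app q ` car c = (\<lambda>t. 2 * t) ` car c" using q(2) by simp
  have rest: "car d - app q ` car c = (\<lambda>s. 2 * s + 1) ` ?N"
    unfolding qim d(1) S_def by auto presburger
  have qi: "inj_on (app q) (car c)" using q(2) by (auto simp: inj_on_def)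
  have "is_pushout endo_cat f g p q"
  proof (rule is_pushout_endoI[OF f(2) g p(1) q(1) _ qi])
    show "app p (app f s) = app q (app g s)" if "s \<in> car a" for s
      using that p(2) q(2) fh(1) gh(1) ppf by simp
    have "app p s = 2 * s + 1" if "s \<in> ?N" for s using that p(2) ppn by simp
    then show "bij_betw (app p) ?N (car d - app q ` car c)"
      unfolding rest bij_betw_def by (auto simp: inj_on_def)
  qed
  moreover have "even (card {y \<in> car d - app q ` car c. act d y = app q t})" if t: "t \<in> car c - {0}" for t
  proof -
    let ?A = "{r \<in> car a. app g r = t}"
    let ?F = "\<lambda>r. {s \<in> ?N. act b s = app f r}"
    have act: "act d (2 * s + 1) = pp (act b s)" if "s \<in> ?N" for s
      using dp[of s] ppn[OF that] that by simp
    have "pp s = 2 * t \<longleftrightarrow> (\<exists>r \<in> ?A. s = app f r)" if "s \<in> car b" for s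
    proof (cases "s \<in> app f ` car a")
      case True then show ?thesis using ppf inj by (auto dest: inj_onD)
    next
      case False
      then show ?thesis using that ppn[of s] by (auto; presburger)
    qed
    then have "{y \<in> car d - app q ` car c. act d y = app q t} = (\<lambda>s. 2 * s + 1) ` (\<Union>r \<in> ?A. ?F r)"
      unfolding rest using act q(2) t ppf by (auto simp: act_in_car)
    then have "card {y \<in> car d - app q ` car c. act d y = app q t} = card (\<Union>r \<in> ?A. ?F r)"
      by (simp add: card_image inj_on_def)
    also have "\<dots> = (\<Sum>r \<in> ?A. card (?F r))"
      using inj by (intro card_UN_disjoint) (auto simp: finite_car dest: inj_onD)
    also have "even \<dots>"
    proof (rule dvd_sum)
      \<comment> \<open>The index \<open>0\<close> does not occur, as \<open>g\<close> preserves the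
        base point and \<open>t\<close> is nonzero; so the parity condition on \<open>f\<close>
        applies.\<close>
      fix r assume "r \<in> ?A"
      moreover from this have "r \<noteq> 0" using t gh(2) by (intro notI) auto
      ultimately have "r \<in> car a - {0}" by blast
      then show "even (card (?F r))" using f' by blast
    qed
    finally show ?thesis .
  qed
  then have "q \<in> Cof endo_cat" using qi by (simp add: Cof_endo_cat[OF q(1)])
  moreover have "card (car d) = card (car c) + card ?N"
  proof -
    have "card (car d) = card ((\<lambda>t. 2 * t) ` car c) + card ((\<lambda>s. 2 * s + 1) ` ?N)"
      unfolding d(1) S_def by (intro card_Un_disjoint) (auto simp: finite_car, presburger)
    then show ?thesis by (simp add: card_image inj_on_def)
  qed
  ultimately show ?thesis using that p(1) q(1) by blast
qed

section \<open>The zero object and the axioms for cofibrations\<close>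

lemma car_Zero: "car (Zero endo_cat) = {0}"
proof -
  obtain a where "car a = {0}" using endo_ob_ex[of "{0}" "\<lambda>s. s"] by auto
  then have "car (SOME a. car a = {0}) = {0}" by (rule someI)
  then show ?thesis by (simp add: endo_cat_def)
qed

lemma endo_zero: "is_zero_object endo_cat (Zero endo_cat)"
  unfolding is_zero_object_def
proof (intro conjI ballI)
  show "Zero endo_cat \<in> Ob endo_cat" by (simp add: endo_cat_def)
next
  fix a
  obtain m where m: "m \<in> Hom endo_cat (Zero endo_cat) a"
    using endo_hom_ex[of "Zero endo_cat" "\<lambda>_. 0" a] by (auto simp: zero_in_car act_0)
  show "\<exists>!f. f \<in> Hom endo_cat (Zero endo_cat) a"
  proof (rule ex1I)
    show "m \<in> Hom endo_cat (Zero endo_cat) a" by (rule m)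
  next
    fix f assume f: "f \<in> Hom endo_cat (Zero endo_cat) a"
    show "f = m"
      by (rule endo_hom_eqI[OF f m]) (simp add: car_Zero endo_homD(2)[OF f] endo_homD(2)[OF m])
  qed
  obtain m where m: "m \<in> Hom endo_cat a (Zero endo_cat)"
    using endo_hom_ex[of a "\<lambda>_. 0" "Zero endo_cat"] by (auto simp: zero_in_car act_0)
  show "\<exists>!f. f \<in> Hom endo_cat a (Zero endo_cat)"
  proof (rule ex1I)
    show "m \<in> Hom endo_cat a (Zero endo_cat)" by (rule m)
  next
    fix f assume f: "f \<in> Hom endo_cat a (Zero endo_cat)"
    show "f = m"
      by (rule endo_hom_eqI[OF f m])
        (use endo_homD(1)[OF f] endo_homD(1)[OF m] in \<open>simp add: car_Zero\<close>)
  qed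
qed

lemma category_with_cofibrations_endo_cat: "category_with_cofibrations endo_cat"
proof
  show "is_zero_object endo_cat (Zero endo_cat)" by (rule endo_zero)
  show "Cof endo_cat \<subseteq> Mor endo_cat" by (auto simp: endo_cat_def)
next
  fix f a assume f: "f \<in> Hom endo_cat (Zero endo_cat) a"
  show "f \<in> Cof endo_cat" by (simp add: Cof_endo_cat[OF f] car_Zero)
next
  fix f assume "is_iso endo_cat f"
  then show "f \<in> Cof endo_cat" by (rule endo_cof_iso)
next
  fix f g assume "f \<in> Cof endo_cat" "g \<in> Cof endo_cat" "Cod endo_cat f = Dom endo_cat g"
  moreover have "Cof endo_cat \<subseteq> Mor endo_cat" by (auto simp: endo_cat_def)
  ultimately show "Comp endo_cat g f \<in> Cof endo_cat"
    by (intro endo_cof_comp[of f "Dom endo_cat f" "Cod endo_cat f" g "Cod endo_cat g"]) (auto simp: Hom_def)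
next
  fix f g assume f: "f \<in> Cof endo_cat" and g: "g \<in> Mor endo_cat" "Dom endo_cat f = Dom endo_cat g"
  have "f \<in> Mor endo_cat" using f by (auto simp: endo_cat_def)
  then have h: "f \<in> Hom endo_cat (Dom endo_cat f) (Cod endo_cat f)"
    "g \<in> Hom endo_cat (Dom endo_cat f) (Cod endo_cat g)"
    using g by (simp_all add: Hom_def)
  show "\<exists>p q. is_pushout endo_cat f g p q"
    using endo_pushout_ex[OF f h] by metis
next
  fix f g p q assume f: "f \<in> Cof endo_cat" and P: "is_pushout endo_cat f g p q"
  have h: "f \<in> Hom endo_cat (Dom endo_cat f) (Cod endo_cat f)"
    "g \<in> Hom endo_cat (Dom endo_cat f) (Cod endo_cat g)"
    using P by (simp_all add: Hom_def is_pushout_def)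
  \<comment> \<open>An arbitrary cobase change is the explicit one followed by an isomorphism, hence
    a composite of cofibrations.\<close>
  obtain d p' q' where p': "p' \<in> Hom endo_cat (Cod endo_cat f) d"
    and q': "q' \<in> Hom endo_cat (Cod endo_cat g) d" "q' \<in> Cof endo_cat" and P': "is_pushout endo_cat f g p' q'"
    using endo_pushout_ex[OF f h] by metis
  obtain k where k: "k \<in> Hom endo_cat (Cod endo_cat p') (Cod endo_cat p)" "is_iso endo_cat k"
      "Comp endo_cat k q' = q"
    using endo.pushout_unique[OF P' P] by metis
  have "Cod endo_cat p' = d" using p' by (simp add: Hom_def)
  then show "q \<in> Cof endo_cat"
    using endo_cof_comp[OF q'(2,1) endo_cof_iso[OF k(2)]] k(1,3) by simp
qed

interpretation endo: category_with_cofibrations endo_cat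
  by (rule category_with_cofibrations_endo_cat)

text \<open>The quotient consists of the base point and the complement of the image of
  \<open>f\<close>. The \<open>+ 1\<close> appears because the base point is counted in both
  \<open>a\<close> and \<open>c\<close>.\<close>

lemma cofibration_sequence_card:
  assumes s: "is_cofibration_sequence endo_cat f p" and f: "f \<in> Hom endo_cat a b" and p: "p \<in> Hom endo_cat b c"
  shows "card (car b) + 1 = card (car a) + card (car c)"
proof -
  have c: "f \<in> Cof endo_cat" using s by (simp add: is_cofibration_sequence_def)
  obtain z w where z: "z \<in> Hom endo_cat a (Zero endo_cat)" and P: "is_pushout endo_cat f z p w"
    using s f by (auto simp: is_cofibration_sequence_def Hom_def)
  obtain d p' q' where p': "p' \<in> Hom endo_cat b d" "is_pushout endo_cat f z p' q'"
    and d: "card (car d) = card (car (Zero endo_cat)) + card (car b - app f ` car a)"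
    using endo_pushout_ex[OF c f z] by metis
  obtain k where "k \<in> Hom endo_cat d c" "is_iso endo_cat k"
    using endo.pushout_unique[OF p'(2) P] p'(1) p by (metis Hom_iff)
  then have "card (car d) = card (car c)" using is_iso_endo_bij bij_betw_same_card by blast
  moreover have "card (car b - app f ` car a) + card (app f ` car a) = card (car b)"
  proof -
    have "app f ` car a \<subseteq> car b" using endo_homD(1)[OF f] by auto
    then show ?thesis using finite_car by (metis card_Diff_subset card_mono finite_subset le_add_diff_inverse2)
  qed
  moreover have "card (app f ` car a) = card (car a)"
    using c by (simp add: Cof_endo_cat[OF f] card_image)
  ultimately show ?thesis using d by (simp add: car_Zero)
qed

lemma cofibration_sequence_endoI:
  assumes f: "f \<in> Cof endo_cat" "f \<in> Hom endo_cat a b" and p: "p \<in> Hom endo_cat b c"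
    and 0: "\<And>s. s \<in> car a \<Longrightarrow> app p (app f s) = 0"
    and bij: "bij_betw (app p) (car b - app f ` car a) (car c - {0})"
  shows "is_cofibration_sequence endo_cat f p"
proof -
  obtain z w where z: "z \<in> Hom endo_cat a (Zero endo_cat)" and w: "w \<in> Hom endo_cat (Zero endo_cat) c"
    using endo.to_zero_ex[of a] endo.from_zero_ex[of c] by (auto simp: endo_cat_def)
  have "app z s = 0" if "s \<in> car a" for s using endo_homD(1)[OF z that] by (simp add: car_Zero)
  then have "is_pushout endo_cat f z p w"
    using 0 bij by (intro is_pushout_endoI[OF f(2) z p w]) (simp_all add: car_Zero endo_homD(2)[OF w])
  then show ?thesis
    using f z w p unfolding is_cofibration_sequence_def by (auto simp: Hom_def)
qed

section \<open>Compatible triangles without a filler\<close>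

text \<open>By the cardinalities \<open>a\<close> has one nonzero element \<open>x\<close>, and
  \<open>e\<close> has one element \<open>y\<close> outside the image of \<open>u\<close>. The
  condition on \<open>b\<close>, read back along the injection \<open>v\<close>, forces the self-map
  to send \<open>y\<close> to \<open>u x\<close>. This single preimage violates parity for
  \<open>u\<close>.\<close>

lemma no_cofibration_filler:
  assumes u: "u \<in> Cof endo_cat" "u \<in> Hom endo_cat a e" and v: "v \<in> Cof endo_cat" "v \<in> Hom endo_cat e b"
    and a: "card (car a) = 2" and e: "card (car e) = 3"
    and act: "\<And>y. y \<in> car b - app v ` app u ` car a \<Longrightarrow> act b y \<in> app v ` app u ` (car a - {0})"
  shows False
proof -
  note uh = endo_homD[OF u(2)] and vh = endo_homD[OF v(2)]
  note u' = u(1)[unfolded Cof_endo_cat[OF u(2)]]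
  have vi: "inj_on (app v) (car e)" using v(1) Cof_endo_cat[OF v(2)] by blast
  have "card (car a - {0}) = 1" using a zero_in_car[of a] by simp
  then obtain x where x: "car a - {0} = {x}" by (auto simp: card_1_singleton_iff)
  have ux: "app u x \<in> car e" "app u ` car a \<subseteq> car e" using x uh(1) by auto
  have "card (app u ` car a) = 2" using u' a by (simp add: card_image)
  then have "card (car e - app u ` car a) = 1"
    using e ux(2) finite_car by (simp add: card_Diff_subset)
  then obtain y where y: "car e - app u ` car a = {y}" by (auto simp: card_1_singleton_iff)
  have ye: "y \<in> car e" using y by blast
  have "app v y \<notin> app v ` app u ` car a"
    using y ux(2) inj_on_image_mem_iff[OF vi, of y "app u ` car a"] by blast
  then have "act b (app v y) = app v (app u x)"
  proof -
    have "act b (app v y) \<in> app v ` app u ` (car a - {0})"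
      using act[of "app v y"] vh(1)[OF ye] \<open>app v y \<notin> app v ` app u ` car a\<close> by blast
    then show ?thesis by (simp add: x)
  qed
  then have "act e y = app u x"
    using ye vh(3)[OF ye] inj_onD[OF vi, of "act e y" "app u x"] ux(1) by (simp add: act_in_car)
  then have "card {z \<in> car e - app u ` car a. act e z = app u x} = 1"
    unfolding y by (simp add: conj_commute Collect_conv_if)
  moreover have "x \<in> car a - {0}" using x by blast
  then have "even (card {z \<in> car e - app u ` car a. act e z = app u x})" using u' by blast
  ultimately show False by simp
qed

text \<open>The number 4 is the element called \<open>a\<close> in the overview, and 2 and 3 are
  \<open>d\<close> and \<open>d'\<close>; \<open>p\<close> collapses 4 and \<open>q\<close>
  collapses 2. The last conclusion says that 2 and 3 map to 4, in a form that can be transported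
  along isomorphisms.\<close>

lemma unliftable_sequences:
  obtains f p g q where "is_cofibration_sequence endo_cat f p" "is_cofibration_sequence endo_cat g q"
    "Cod endo_cat g = Cod endo_cat p"
    "card (car (Dom endo_cat f)) = 2" "card (car (Dom endo_cat g)) = 2"
    "\<And>y. y \<in> car (Cod endo_cat f) - app f ` car (Dom endo_cat f) \<Longrightarrow>
      act (Cod endo_cat f) y \<in> app f ` (car (Dom endo_cat f) - {0})"
proof -
  have ob: "\<exists>a. car a = S \<and> (\<forall>s \<in> S. act a s = 0)" if "finite S" "0 \<in> S" for S
    by (rule endo_ob_ex[OF that]) (use that in auto)
  obtain a where a: "car a = {0, 4}" "act a 0 = 0" "act a 4 = 0" using ob[of "{0, 4}"] by auto
  obtain d where d: "car d = {0, 2}" "act d 0 = 0" "act d 2 = 0" using ob[of "{0, 2}"] by auto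
  obtain d' where d': "car d' = {0, 3}" "act d' 0 = 0" "act d' 3 = 0" using ob[of "{0, 3}"] by auto
  obtain c where c: "car c = {0, 2, 3}" "act c 0 = 0" "act c 2 = 0" "act c 3 = 0"
    using ob[of "{0, 2, 3}"] by auto
  have "\<exists>b. car b = {0, 2, 3, 4} \<and> (\<forall>s \<in> {0, 2, 3, 4}. act b s = (if s \<in> {2, 3} then 4 else 0))"
    by (rule endo_ob_ex) auto
  then obtain b where b: "car b = {0, 2, 3, 4}" "act b 0 = 0" "act b 2 = 4" "act b 3 = 4" "act b 4 = 0"
    by auto
  have "\<exists>f \<in> Hom endo_cat a b. \<forall>s \<in> car a. app f s = s"
    by (rule endo_hom_ex) (auto simp: a b)
  then obtain f where f: "f \<in> Hom endo_cat a b" "app f 0 = 0" "app f 4 = 4" using a(1) by auto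
  have "\<exists>p \<in> Hom endo_cat b c. \<forall>s \<in> car b. app p s = (if s = 4 then 0 else s)"
    by (rule endo_hom_ex) (auto simp: b c)
  then obtain p where p: "p \<in> Hom endo_cat b c" "app p 0 = 0" "app p 4 = 0" "app p 2 = 2" "app p 3 = 3"
    using b(1) by auto
  have "\<exists>g \<in> Hom endo_cat d c. \<forall>s \<in> car d. app g s = s"
    by (rule endo_hom_ex) (auto simp: c d)
  then obtain g where g: "g \<in> Hom endo_cat d c" "app g 0 = 0" "app g 2 = 2" using d(1) by auto
  have "\<exists>q \<in> Hom endo_cat c d'. \<forall>s \<in> car c. app q s = (if s = 3 then 3 else 0)"
    by (rule endo_hom_ex) (auto simp: c d')
  then obtain q where q: "q \<in> Hom endo_cat c d'" "app q 0 = 0" "app q 2 = 0" "app q 3 = 3"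
    using c(1) by auto
  have fim: "app f ` car a = {0, 4}" "app f ` (car a - {0}) = {4}" using f(2,3) a(1) by auto
  have gim: "app g ` car d = {0, 2}" using g(2,3) d(1) by auto
  have bf: "car b - app f ` car a = {2, 3}" unfolding fim b(1) by auto
  have cg: "car c - app g ` car d = {3}" unfolding gim c(1) by auto
  have "{y \<in> {2, 3}. act b y = app f 4} = {2, 3}" using b f by auto
  then have "f \<in> Cof endo_cat"
    unfolding Cof_endo_cat[OF f(1)] bf using f a(1) by (auto simp: inj_on_def)
  then have fp: "is_cofibration_sequence endo_cat f p"
    by (rule cofibration_sequence_endoI[OF _ f(1) p(1)])
      (unfold bf, unfold a(1) c(1), use f p in \<open>auto simp: bij_betw_def\<close>)
  \<comment> \<open>The quotient \<open>c\<close> has zero self-map, so the relevant fibre is empty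
    and its size is even.\<close>
  have "{y \<in> {3}. act c y = app g 2} = {}" using c g by auto
  then have "even (card {y \<in> {3}. act c y = app g 2})" by (simp only: card.empty even_zero)
  moreover have "car d - {0} = {2}" using d(1) by auto
  ultimately have "\<forall>s \<in> car d - {0}. even (card {y \<in> {3}. act c y = app g s})" by simp
  then have "g \<in> Cof endo_cat"
    unfolding Cof_endo_cat[OF g(1)] cg using g(2,3) d(1) by (simp add: inj_on_def)
  then have gq: "is_cofibration_sequence endo_cat g q"
    by (rule cofibration_sequence_endoI[OF _ g(1) q(1)])
      (unfold cg, unfold d(1) d'(1), use g q in \<open>auto simp: bij_betw_def\<close>)
  have D: "Dom endo_cat f = a" "Cod endo_cat f = b" "Dom endo_cat g = d" "Cod endo_cat g = c"
    "Cod endo_cat p = c"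
    using f g p by (simp_all add: Hom_def)
  show ?thesis
  proof (rule that[OF fp gq], unfold D)
    fix y assume "y \<in> car b - app f ` car a"
    then show "act b y \<in> app f ` (car a - {0})" unfolding bf fim using b by auto
  qed (simp_all add: a d)
qed

text \<open>The first isomorphism identifies \<open>v\<close> after \<open>u\<close> with
  \<open>f\<close>, and the second gives the quotient of \<open>u\<close> the size of the source of
  \<open>g\<close>. So the middle object \<open>e\<close> has 2 + 2 - 1 = 3 elements, and
  \<open>no_cofibration_filler\<close> applies.\<close>

lemma endo_triangles_no_filler:
  assumes s: "is_cofibration_sequence endo_cat f p"
    and c: "card (car (Dom endo_cat f)) = 2" "card (car (Dom endo_cat g)) = 2"
    and act: "\<And>y. y \<in> car (Cod endo_cat f) - app f ` car (Dom endo_cat f) \<Longrightarrow>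
      act (Cod endo_cat f) y \<in> app f ` (car (Dom endo_cat f) - {0})"
    and M: "M \<in> S_ob endo_cat I" and I: "{w, i, j, k} \<subseteq> I" "w < i" "i < j" "j < k"
    and \<phi>: "\<phi> w = 0" "\<phi> i = 1" "\<phi> k = 2" and \<psi>: "\<psi> i = 0" "\<psi> j = 1" "\<psi> k = 2"
    and A: "(S_pull {w, i, k} id M, S_pull {w, i, k} \<phi> (endo.triangle f p)) \<in> iso_rel (S_cat endo_cat {w, i, k})"
    and B: "(S_pull {i, j, k} id M, S_pull {i, j, k} \<psi> (endo.triangle g q)) \<in> iso_rel (S_cat endo_cat {i, j, k})"
  shows False
proof -
  note M' = S_obD[OF M]
  define a b e d where "a = fst M (w, i)" and "b = fst M (w, k)" and "e = fst M (w, j)" and "d = fst M (i, j)"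
  define u v r where "u = snd M ((w, i), (w, j))" and "v = snd M ((w, j), (w, k))" and "r = snd M ((w, j), (i, j))"
  have ar: "((w, i), (w, j)) \<in> Ar_rel I" "((w, j), (w, k)) \<in> Ar_rel I" "((w, j), (i, j)) \<in> Ar_rel I"
    using I by (auto simp: Ar_rel_def Ar_def)
  have u: "u \<in> Hom endo_cat a e" and v: "v \<in> Hom endo_cat e b" and r: "r \<in> Hom endo_cat e d"
    unfolding u_def v_def r_def a_def b_def e_def d_def by (rule M'(2)[OF ar(1)], rule M'(2)[OF ar(2)], rule M'(2)[OF ar(3)])
  have us: "is_cofibration_sequence endo_cat u r" unfolding u_def r_def using M'(6) I by simp
  then have uc: "u \<in> Cof endo_cat" by (simp add: is_cofibration_sequence_def)
  have "is_cofibration_sequence endo_cat v (snd M ((w, k), (j, k)))" unfolding v_def using M'(6) I by simp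
  then have vc: "v \<in> Cof endo_cat" by (simp add: is_cofibration_sequence_def)
  have vu: "snd M ((w, i), (w, k)) = Comp endo_cat v u"
    unfolding u_def v_def by (rule M'(4)[OF ar(1,2)])
  let ?N = "endo.triangle f p" and ?L = "endo.triangle g q"
  obtain \<eta> where \<eta>: "is_nat_trans endo_cat {w, i, k} (S_pull {w, i, k} id M) (S_pull {w, i, k} \<phi> ?N) \<eta>"
    "\<And>x. x \<in> Ar {w, i, k} \<Longrightarrow> is_iso endo_cat (\<eta> x)"
    by (rule endo.S_cat_iso_components[OF A]) blast
  obtain \<theta> where \<theta>: "is_nat_trans endo_cat {i, j, k} (S_pull {i, j, k} id M) (S_pull {i, j, k} \<psi> ?L) \<theta>"
    "\<And>x. x \<in> Ar {i, j, k} \<Longrightarrow> is_iso endo_cat (\<theta> x)"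
    by (rule endo.S_cat_iso_components[OF B]) blast
  have x: "(w, i) \<in> Ar {w, i, k}" "(w, k) \<in> Ar {w, i, k}" "((w, i), (w, k)) \<in> Ar_rel {w, i, k}"
    "(i, j) \<in> Ar {i, j, k}"
    "(0, 1) \<in> Ar {0, 1, 2}" "(0, 2) \<in> Ar {0, 1, 2}" "((0, 1), (0, 2)) \<in> Ar_rel {0, 1, 2}"
    using I by (auto simp: Ar_def Ar_rel_def)
  let ?a = "Dom endo_cat f" and ?b = "Cod endo_cat f" and ?d = "Dom endo_cat g"
  have \<eta>a: "\<eta> (w, i) \<in> Hom endo_cat a ?a" and \<eta>b: "\<eta> (w, k) \<in> Hom endo_cat b ?b"
    using is_nat_transD(2)[OF \<eta>(1) x(1)] is_nat_transD(2)[OF \<eta>(1) x(2)] x \<phi>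
    by (simp_all add: S_pull_def a_def b_def endo.triangle_def endo.triangle_ob_def)
  have \<theta>d: "\<theta> (i, j) \<in> Hom endo_cat d ?d"
    using is_nat_transD(2)[OF \<theta>(1) x(4)] x \<psi>
    by (simp add: S_pull_def d_def endo.triangle_def endo.triangle_ob_def)
  have nat: "Comp endo_cat (\<eta> (w, k)) (Comp endo_cat v u) = Comp endo_cat f (\<eta> (w, i))"
    using is_nat_transD(3)[OF \<eta>(1) x(3)] x \<phi> vu
    by (simp add: S_pull_def endo.triangle_def endo.triangle_mor_def)
  have f: "f \<in> Hom endo_cat ?a ?b"
    using s by (auto simp: is_cofibration_sequence_def is_pushout_def Hom_def)
  note bi = is_iso_endo_bij[OF \<eta>(2)[OF x(1)] \<eta>a] is_iso_endo_bij[OF \<eta>(2)[OF x(2)] \<eta>b]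
    is_iso_endo_bij[OF \<theta>(2)[OF x(4)] \<theta>d]
  have ca: "card (car a) = 2" "card (car d) = 2"
    using bij_betw_same_card[OF bi(1)] bij_betw_same_card[OF bi(3)] c by simp_all
  then have ce: "card (car e) = 3" using cofibration_sequence_card[OF us u r] by simp
  let ?w = "\<lambda>t. app v (app u t)"
  have wf: "app (\<eta> (w, k)) (?w t) = app f (app (\<eta> (w, i)) t)" if "t \<in> car a" for t
    using arg_cong[OF nat, of "\<lambda>m. app m t"] that
      endo_comp(2)[OF endo_comp(1)[OF u v] \<eta>b that] endo_comp(2)[OF u v that] endo_comp(2)[OF \<eta>a f that]
    by simp
  have wb: "?w t \<in> car b" if "t \<in> car a" for t
    using endo_homD(1)[OF v endo_homD(1)[OF u that]] .
  show False
  proof (rule no_cofibration_filler[OF uc u vc v ca(1) ce])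
    fix y assume y: "y \<in> car b - app v ` app u ` car a"
    \<comment> \<open>The component at \<open>(w, k)\<close> carries the image of \<open>a\<close>
      in \<open>b\<close> onto the image of \<open>f\<close>. So a point outside goes outside, where
      the hypothesis on \<open>f\<close> applies, and the conclusion is brought back along the same
      component.\<close>
    have "app (\<eta> (w, k)) y \<notin> app f ` car ?a"
    proof
      assume "app (\<eta> (w, k)) y \<in> app f ` car ?a"
      then have "app (\<eta> (w, k)) y \<in> app f ` app (\<eta> (w, i)) ` car a"
        using bi(1) by (simp add: bij_betw_def)
      then obtain t where "t \<in> car a" "app (\<eta> (w, k)) y = app f (app (\<eta> (w, i)) t)"
        by blast
      then have "y = ?w t"
        using wf[of t] wb[of t] y inj_onD[OF bij_betw_imp_inj_on[OF bi(2)], of y "?w t"] by simp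
      then show False using y \<open>t \<in> car a\<close> by blast
    qed
    moreover have "app (\<eta> (w, k)) y \<in> car ?b" using y endo_homD(1)[OF \<eta>b, of y] by simp
    ultimately have "act ?b (app (\<eta> (w, k)) y) \<in> app f ` (car ?a - {0})"
      by (intro act DiffI)
    then obtain t' where t': "t' \<in> car ?a" "t' \<noteq> 0" "act ?b (app (\<eta> (w, k)) y) = app f t'" by blast
    obtain t where t: "t \<in> car a" "t' = app (\<eta> (w, i)) t"
      using t'(1) bi(1) by (auto simp: bij_betw_def)
    have "app (\<eta> (w, k)) (act b y) = app (\<eta> (w, k)) (?w t)"
      using t'(3) endo_homD(3)[OF \<eta>b, of y] y wf[OF t(1)] t(2) by simp
    then have "act b y = ?w t"
      using bi(2) wb[OF t(1)] y by (auto simp: bij_betw_def act_in_car dest: inj_onD)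
    moreover have "t \<noteq> 0" using t'(2) t(2) endo_homD(2)[OF \<eta>a] by metis
    ultimately show "act b y \<in> app v ` app u ` (car a - {0})" using t(1) by blast
  qed
qed

theorem proposition6p5:
  fixes n :: nat and T :: "nat set set"
  assumes "n \<ge> 3"
    and "is_triangulation n T"
    and "\<exists>t \<in> T. 0 \<notin> t"
  shows "\<exists>C :: (nat, nat) cofcat. category_with_cofibrations C \<and>
    \<not> (segal_limit (iso_s C) n T \<subseteq> segal_map (iso_s C) n T ` Sim (iso_s C) {0..n})"
proof (intro exI conjI)
  show "category_with_cofibrations endo_cat" by (rule category_with_cofibrations_endo_cat)
  obtain i j k where ijk: "0 < i" "i < j" "j < k" "k \<le> n" "{i, j, k} \<in> T" "{0, i, k} \<in> T"
    using triangulation_triangle_not_0[OF assms(2,3)] .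
  obtain f p g q where fp: "is_cofibration_sequence endo_cat f p" and gq: "is_cofibration_sequence endo_cat g q"
    and cod: "Cod endo_cat g = Cod endo_cat p"
    and card: "card (car (Dom endo_cat f)) = 2" "card (car (Dom endo_cat g)) = 2"
    and act: "\<And>y. y \<in> car (Cod endo_cat f) - app f ` car (Dom endo_cat f) \<Longrightarrow>
      act (Cod endo_cat f) y \<in> app f ` (car (Dom endo_cat f) - {0})"
    by (rule unliftable_sequences) blast
  let ?A = "endo.triangle f p" and ?B = "endo.triangle g q"
  note A = endo.triangle_in_S_ob[OF fp] and B = endo.triangle_in_S_ob[OF gq]
  \<comment> \<open>\<open>\<phi>\<close> sends 0, i, k to 0, 1, 2, and \<open>\<psi>\<close> sends
    i, j, k to 0, 1, 2. Both are monotone on all of \<open>{0..n}\<close>, so each provides a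
    simplex on every cell.\<close>
  define \<phi> \<psi> :: "nat \<Rightarrow> nat"
    where "\<phi> x = (if x < i then 0 else if x < k then 1 else 2)"
      and "\<psi> x = (if x < j then 0 else if x < k then 1 else 2)" for x
  have m: "ordinal_map J {0, 1, 2} \<phi>" "ordinal_map J {0, 1, 2} \<psi>" if "ordinal J" for J
    using that ijk(2,3) by (auto simp: ordinal_map_def ordinal_def mono_on_def \<phi>_def \<psi>_def)
  define cls where "cls I M = iso_rel (S_cat endo_cat I) `` {M}" for I M
  have sim: "cls I M \<in> Sim (iso_s endo_cat) I" if "M \<in> S_ob endo_cat I" for I M
    unfolding cls_def by (rule endo.iso_s_simI[OF that])
  \<comment> \<open>Cells on the side of \<open>j\<close> use the second triangle, all others the
    first.\<close>
  define x where "x = (\<lambda>I \<in> cells n T. if I \<subseteq> {i..k} then cls I (S_pull I \<psi> ?B) else cls I (S_pull I \<phi> ?A))"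
  have sub: "I \<subseteq> {0..n} \<and> ordinal I \<and> card I \<ge> 2 \<and> (I \<subseteq> {i..k} \<or> I \<inter> {i<..<k} = {})"
    if "I \<in> cells n T" for I
  proof -
    obtain t where t: "t \<in> T" "I \<subseteq> t" "card I \<ge> 2"
      using \<open>I \<in> cells n T\<close> triangulation_triangle(2)[OF assms(2)] by (fastforce simp: cells_def diagonals_def)
    note t' = triangulation_triangle[OF assms(2) t(1)]
    \<comment> \<open>A triangle with one vertex strictly inside the arc and one strictly outside
      would cross the edge from \<open>i\<close> to \<open>k\<close>.\<close>
    have "t \<subseteq> {i..k} \<or> t \<inter> {i<..<k} = {}"
      using triangulation_noncrossing[OF assms(2) t(1) ijk(5), of i k] by fastforce
    moreover have "ordinal I" using t t' finite_subset[OF t(2)] by (auto simp: ordinal_def)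
    ultimately show ?thesis using t t' by blast
  qed
  have edge: "S_pull {i, k} \<phi> ?A = S_pull {i, k} \<psi> ?B"
    using ijk by (intro endo.S_pull_triangle_edge[OF cod]) (auto simp: \<phi>_def \<psi>_def)
  have pull: "Act (iso_s endo_cat) I J id (cls J (S_pull J \<phi> ?A)) = cls I (S_pull I \<phi> ?A)"
    "Act (iso_s endo_cat) I J id (cls J (S_pull J \<psi> ?B)) = cls I (S_pull I \<psi> ?B)"
    if "ordinal J" "I \<subseteq> J" "I \<noteq> {}" for I J
    unfolding cls_def using endo.iso_s_act_pull[OF A m(1) that(2,3)] endo.iso_s_act_pull[OF B m(2) that(2,3)] that(1)
    by blast+
  have "x \<in> segal_limit (iso_s endo_cat) n T"
    unfolding segal_limit_def
  proof (intro CollectI conjI ballI impI PiE_I)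
    fix I assume "I \<in> cells n T"
    then show "x I \<in> Sim (iso_s endo_cat) I"
      using sub m endo.S_pull_in[OF _ A] endo.S_pull_in[OF _ B] sim by (simp add: x_def)
  next
    fix I J assume IJ: "I \<in> cells n T" "J \<in> cells n T" "I \<subseteq> J"
    have ne: "I \<noteq> {}" and J: "ordinal J" using sub IJ by (auto simp: ordinal_def)
    consider "J \<subseteq> {i..k}" | "\<not> I \<subseteq> {i..k}" | "\<not> J \<subseteq> {i..k}" "I \<subseteq> {i..k}" by blast
    then show "Act (iso_s endo_cat) I J id (x J) = x I"
    proof cases
      case 1
      then have "I \<subseteq> {i..k}" using IJ by blast
      then show ?thesis using 1 IJ pull(2)[OF J IJ(3) ne] by (simp add: x_def)
    next
      case 2
      then have "\<not> J \<subseteq> {i..k}" using IJ by blast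
      then show ?thesis using 2 IJ pull(1)[OF J IJ(3) ne] by (simp add: x_def)
    next
      case 3
      \<comment> \<open>A cell on the side of \<open>j\<close> inside a cell beyond it must be the
        chord \<open>{i, k}\<close>, where both rules for \<open>x\<close> agree by
        \<open>edge\<close>.\<close>
      then have "J \<inter> {i<..<k} = {}" using sub IJ(2) by blast
      then have "I \<subseteq> {i, k}" using 3 IJ(3) by fastforce
      moreover have "card {i, k} \<le> card I" using sub[OF IJ(1)] ijk by simp
      ultimately have "I = {i, k}" by (intro card_seteq) auto
      then show ?thesis using 3 IJ pull(1)[OF J IJ(3) ne] edge by (simp add: x_def)
    qed
  qed (simp add: x_def)
  moreover have "x \<notin> segal_map (iso_s endo_cat) n T ` Sim (iso_s endo_cat) {0..n}"
  proof
    assume "x \<in> segal_map (iso_s endo_cat) n T ` Sim (iso_s endo_cat) {0..n}"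
    then obtain M where M: "M \<in> S_ob endo_cat {0..n}" and x: "x = segal_map (iso_s endo_cat) n T (cls {0..n} M)"
      by (auto simp: cls_def elim: endo.iso_s_simE)
    \<comment> \<open>For a lift, equality of classes on a triangle yields an isomorphism of
      objects; this is applied on both sides of the chord.\<close>
    have "(S_pull t id M, N) \<in> iso_rel (S_cat endo_cat t)"
      if t: "t \<in> T" and N: "x t = cls t N" "N \<in> S_ob endo_cat t" for t N
    proof -
      have "t \<in> cells n T" using t by (simp add: cells_def)
      moreover from sub[OF this] have id: "ordinal_map t {0..n} id"
        by (auto simp: ordinal_map_def ordinal_def mono_on_def)
      ultimately have "cls t (S_pull t id M) = cls t N"
        using N(1) endo.iso_s_act[OF id M] by (simp add: x segal_map_def cls_def)
      then show ?thesis
        using eq_equiv_class[OF _ category.equiv_iso_rel[OF endo.category_S_cat]] N(2)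
        by (simp add: cls_def S_cat_def)
    qed
    note iso = this
    have "{0, i, k} \<in> cells n T" "{i, j, k} \<in> cells n T" using ijk by (auto simp: cells_def)
    note c = this and s = sub[OF this(1)] sub[OF this(2)]
    have "(S_pull {0, i, k} id M, S_pull {0, i, k} \<phi> ?A) \<in> iso_rel (S_cat endo_cat {0, i, k})"
      using iso[OF ijk(6)] c(1) ijk(1) endo.S_pull_in[OF m(1) A] s(1) by (simp add: x_def)
    moreover have "(S_pull {i, j, k} id M, S_pull {i, j, k} \<psi> ?B) \<in> iso_rel (S_cat endo_cat {i, j, k})"
      using iso[OF ijk(5)] c(2) ijk(2,3) endo.S_pull_in[OF m(2) B] s(2) by (simp add: x_def)
    ultimately show False
      using ijk by (intro endo_triangles_no_filler[OF fp card act M, of 0 i j k \<phi> \<psi>])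
        (auto simp: \<phi>_def \<psi>_def)
  qed
  ultimately show "\<not> (segal_limit (iso_s endo_cat) n T
      \<subseteq> segal_map (iso_s endo_cat) n T ` Sim (iso_s endo_cat) {0..n})"
    by blast
qed

end
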